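(* Let $N\ge1$ be an integer and $\gamma_N:=\min\{2,N\}$. Assume that $0<q<1$, $0<\gamma<\gamma_N$, $u_0\in C_0(\mathbb{R}^N)$, $u_0\ge0$ and $u_0\neq0$. Let $u\in C([0,\infty);C_0(\mathbb{R}^N))$ be a non-negative solution of the problem $$u_t-\Delta u=|x|^{-\gamma}u^q\ \text{ in }\mathbb{R}^N\times(0,\infty),\qquad u(x,0)=u_0(x)\ \text{ in }\mathbb{R}^N. \qquad (P)$$ Then: (i) $u$ is positive, i.e. $u>0$ in $\mathbb{R}^N\times(0,\infty)$, and it verifies the estimate $$u(x,t)\ge[(1-q)\eta_0]^{1/(1-q)}\,t^{1/(1-q)}\,(|x|+\sqrt{t})^{-\gamma/(1-q)}=:w(x,t)$$ for all $x\in\mathbb{R}^N$ and $t\ge0$ (with $w(x,0)=0$), where $$\eta_0=\eta_0(\gamma)=(4\pi)^{-N/2}\int_{\mathbb{R}^N}\exp\left(-\frac{|z|^2}{4}\right)(1+|z|)^{-\frac{\gamma}{1-q}}\,dz.$$ Moreover, $w\in C([0,\infty);C_0(\mathbb{R}^N))$ and $w$ is a sub-solution of (P) with zero initial datum, i.e. $$w(t)\le\int_0^t\mathbf{S}_\gamma(t-\sigma)\,w^q(\sigma)\,d\sigma .$$ (ii) There exists $\gamma^*\in(0,\gamma_N)$ so that for $0<\gamma<\gamma^*$, $u$ is the unique solution of the problem (P).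
   Context: $C_0(\mathbb{R}^N)$ is the closure in $L^\infty(\mathbb{R}^N)$ of the space of infinitely differentiable functions with compact support in $\mathbb{R}^N$. $\{\mathbf{S}(t)\}_{t\ge0}$ is the heat semigroup: $\mathbf{S}(0)=I$ and, for $t>0$, $[\mathbf{S}(t)\varphi](x)=(4\pi t)^{-N/2}\int_{\mathbb{R}^N}e^{-|x-y|^2/(4t)}\varphi(y)\,dy$. For $t>0$, $[\mathbf{S}_\gamma(t)\varphi](x)=(4\pi t)^{-N/2}\int_{\mathbb{R}^N}e^{-|x-y|^2/(4t)}|y|^{-\gamma}\varphi(y)\,dy$. Solutions of (P) are understood as non-negative solutions in the following sense: a non-negative solution of (P) is a non-negative function $u\in C([0,\infty);C_0(\mathbb{R}^N))$ such that $u(t)=\mathbf{S}(t)u_0+\int_0^t\mathbf{S}_\gamma(t-\sigma)u^q(\sigma)\,d\sigma$ for every $t\in[0,T]$ with $0<T<\infty$. Here $u(t)$ denotes $u(\cdot,t)$, and inequalities between functions of $x$ are pointwise on $\mathbb{R}^N$. *)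

theory Defs
  imports "HOL-Analysis.Analysis"
begin

text \<open>A function is \<open>C\<^sup>k\<close> on the whole space: total differentiability at each level, with every
  directional derivative again \<open>C\<^sup>k\<^sup>-\<^sup>1\<close>.\<close>

primrec Ck_on_space :: "nat \<Rightarrow> ('a::euclidean_space \<Rightarrow> real) \<Rightarrow> bool" where
  "Ck_on_space 0 f \<longleftrightarrow> continuous_on UNIV f"
| "Ck_on_space (Suc k) f \<longleftrightarrow>
     (\<forall>x. f differentiable (at x)) \<and>
     (\<forall>v. Ck_on_space k (\<lambda>x. frechet_derivative f (at x) v))"

definition smooth_compact_support :: "('a::euclidean_space \<Rightarrow> real) \<Rightarrow> bool" where
  "smooth_compact_support f \<longleftrightarrow>
     (\<forall>k. Ck_on_space k f) \<and> compact (closure {x. f x \<noteq> 0})"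

text \<open>The closure of the test functions in \<open>L\<^sup>\<infinity>\<close> is taken inside the Banach space of bounded
  continuous functions with the supremum norm. That space embeds isometrically as a closed subspace
  of \<open>L\<^sup>\<infinity>\<close>, so the closure is the same, with every class represented by its continuous member;
  pointwise statements refer to this representative.\<close>

definition C0 :: "(real^'n \<Rightarrow> real) set" where
  "C0 = apply_bcontfun `
     closure {\<phi> :: (real^'n) \<Rightarrow>\<^sub>C real. smooth_compact_support (apply_bcontfun \<phi>)}"

text \<open>\<open>C([0,\<infinity>); C\<^sub>0)\<close>, with functions written as \<open>u t x\<close>. The values at \<open>t < 0\<close> are
  unconstrained.\<close>

definition C0_curves :: "(real \<Rightarrow> real^'n \<Rightarrow> real) set" where
  "C0_curves = {u. (\<forall>t\<ge>0. u t \<in> C0) \<and> continuous_on {0..} (\<lambda>t. Bcontfun (u t))}"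

definition heat_semigroup :: "real \<Rightarrow> (real^'n \<Rightarrow> real) \<Rightarrow> real^'n \<Rightarrow> real" where
  "heat_semigroup t \<phi> x =
     (if t = 0 then \<phi> x
      else (4 * pi * t) powr (- real CARD('n) / 2) *
           (LINT y|lborel. exp (- (norm (x - y))\<^sup>2 / (4 * t)) * \<phi> y))"

definition heat_semigroup_weighted ::
    "real \<Rightarrow> real \<Rightarrow> (real^'n \<Rightarrow> real) \<Rightarrow> real^'n \<Rightarrow> real" where
  "heat_semigroup_weighted \<gamma> t \<phi> x =
     (4 * pi * t) powr (- real CARD('n) / 2) *
     (LINT y|lborel. exp (- (norm (x - y))\<^sup>2 / (4 * t)) * norm y powr (- \<gamma>) * \<phi> y)"

text \<open>For \<open>u\<close> bounded on \<open>[0,t]\<close> and \<open>0 < \<gamma> < min 2 N\<close>, both the space integral and the time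
  integral below converge absolutely, so no default value of the integral is involved.\<close>

definition duhamel_term ::
    "real \<Rightarrow> real \<Rightarrow> (real \<Rightarrow> real^'n \<Rightarrow> real) \<Rightarrow> real \<Rightarrow> real^'n \<Rightarrow> real" where
  "duhamel_term \<gamma> q u t x =
     (LBINT \<sigma>=0..t. heat_semigroup_weighted \<gamma> (t - \<sigma>) (\<lambda>y. u \<sigma> y powr q) x)"

definition nonneg_solution ::
    "real \<Rightarrow> real \<Rightarrow> (real^'n \<Rightarrow> real) \<Rightarrow> (real \<Rightarrow> real^'n \<Rightarrow> real) \<Rightarrow> bool" where
  "nonneg_solution \<gamma> q u0 u \<longleftrightarrow>
     u \<in> C0_curves \<and> (\<forall>t\<ge>0. \<forall>x. 0 \<le> u t x) \<and>
     (\<forall>t\<ge>0. \<forall>x. u t x = heat_semigroup t u0 x + duhamel_term \<gamma> q u t x)"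

definition eta0 :: "'n::finite itself \<Rightarrow> real \<Rightarrow> real \<Rightarrow> real" where
  "eta0 _ q \<gamma> = (4 * pi) powr (- real CARD('n) / 2) *
     (LINT z|(lborel :: (real^'n) measure).
        exp (- (norm z)\<^sup>2 / 4) * (1 + norm z) powr (- \<gamma> / (1 - q)))"

text \<open>For \<open>q < 1\<close> the value at \<open>t = 0\<close> is \<open>0\<close>, also at \<open>x = 0\<close>, because \<open>0 powr a = 0\<close>.\<close>

definition lower_barrier :: "real \<Rightarrow> real \<Rightarrow> real \<Rightarrow> real^'n \<Rightarrow> real" where
  "lower_barrier q \<gamma> t x =
     ((1 - q) * eta0 TYPE('n) q \<gamma>) powr (1 / (1 - q)) * t powr (1 / (1 - q)) *
     (norm x + sqrt t) powr (- \<gamma> / (1 - q))"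

end

theory Submission
  imports Defs "HOL-Probability.Distributions"
begin

text \<open>Inserting the barrier \<open>w\<close> into the Duhamel integral and using
  \<open>norm (x + sqrt (t - \<sigma>) *\<^sub>R z) + sqrt \<sigma> \<le> (norm x + sqrt t) * (1 + norm z)\<close> decouples the space and time
  integrals, so \<open>w\<close> is a sub-solution. The heat semigroup gives a Gaussian lower bound for every solution
  after a short time. The Duhamel formula raises lower bounds to the power \<open>q < 1\<close>, so iterating it
  flattens this Gaussian multiple of \<open>w\<close> to \<open>w\<close> itself.

  For uniqueness, the difference of two solutions is first shown to be \<open>O(t powr m)\<close> with
  \<open>m = (1 - \<gamma> / 2) / (1 - q)\<close>. Linearizing \<open>u\<^sup>q\<close> above the barrier then yields a linear singular integral
  inequality, which is a contraction for the weight \<open>t powr m\<close>: its constant tends to \<open>q < 1\<close> as \<open>\<gamma>\<close>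
  tends to \<open>0\<close>.\<close>

section \<open>Test functions\<close>

text \<open>Since \<open>q < 1\<close>, the nonlinearity is not Lipschitz at 0 and comparison by
  Lipschitz estimates breaks down. What replaces it: the Duhamel map turns a factor
  \<open>\<theta>\<close> into \<open>\<theta> powr q\<close>, which pushes factors below 1 upwards.
  The barrier is the profile that this map reproduces: the space exponent
  \<open>a = \<gamma> / (1 - q)\<close> solves \<open>\<gamma> + q * a = a\<close>, the time
  exponent \<open>b = 1 / (1 - q)\<close> solves \<open>q * b + 1 = b\<close>, and the constant
  \<open>C\<close> solves \<open>C powr q * (1 - q) * eta0 = C\<close>. The barrier decays
  algebraically in x, the bound inherited from the initial datum only like a Gaussian, so no
  positive multiple of the barrier fits below that bound directly; this forces the detour through
  Gaussian multiples. For uniqueness, linearizing at the barrier costs a factor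
  \<open>1 / \<sigma>\<close>, which is not integrable at 0, so a plain Gronwall argument fails. The
  a priori rate \<open>t powr m\<close> makes the integral converge and contributes
  \<open>1 / m\<close>, which tends to \<open>1 - q\<close> and cancels the
  \<open>1 / (1 - q)\<close> coming from the barrier. Bump functions enter because \<open>C0\<close>
  is a closure of test functions and the barrier has to be placed in it.\<close>

definition flat_exp :: "real poly \<Rightarrow> real \<Rightarrow> real" where
  "flat_exp p s = (if 0 < s then poly p (1 / s) * exp (- 1 / s) else 0)"

lemma tendsto_poly_times_exp_minus:
  fixes p :: "real poly"
  shows "((\<lambda>s. poly p s * exp (- s)) \<longlongrightarrow> 0) at_top"
proof -
  have "((\<lambda>s. \<Sum>i\<le>degree p. coeff p i * (s ^ i / exp s)) \<longlongrightarrow> (\<Sum>i\<le>degree p. coeff p i * 0)) at_top"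
    by (intro tendsto_intros tendsto_power_div_exp_0)
  then show ?thesis
    by (simp add: poly_altdef sum_distrib_right exp_minus divide_inverse mult.assoc)
qed

text \<open>With y = 1/s the derivative of p(y) exp(-y) in s is y^2 (p - p')(y) exp(-y), so the
  family indexed by the polynomial is closed under differentiation. At s = 0 the right difference
  quotient is y p(y) exp(-y), which tends to 0 as y grows.\<close>

lemma has_real_derivative_flat_exp:
  "(flat_exp p has_real_derivative flat_exp ([:0, 0, 1:] * (p - pderiv p)) s) (at s)"
proof -
  consider "s < 0" | "s = 0" | "0 < s" by linarith
  then show ?thesis
  proof cases
    case 1
    have "((\<lambda>_. 0) has_real_derivative 0) (at s)" by simp
    then have "(flat_exp p has_real_derivative 0) (at s)"
      by (rule has_field_derivative_transform_within_open[where S="{..<0}"])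
         (use 1 in \<open>auto simp: flat_exp_def\<close>)
    then show ?thesis using 1 by (simp add: flat_exp_def)
  next
    case 2
    have "((\<lambda>h. flat_exp p h / h) \<longlongrightarrow> 0) (at_right 0)"
    proof -
      have "((\<lambda>s. poly ([:0, 1:] * p) s * exp (- s)) \<longlongrightarrow> 0) at_top"
        by (rule tendsto_poly_times_exp_minus)
      then have "((\<lambda>h. poly ([:0, 1:] * p) (inverse h) * exp (- inverse h)) \<longlongrightarrow> 0) (at_right 0)"
        by (rule filterlim_compose[OF _ filterlim_inverse_at_top_right])
      moreover have "\<forall>\<^sub>F h in at_right 0. poly ([:0, 1:] * p) (inverse h) * exp (- inverse h) = flat_exp p h / h"
        by (auto simp: eventually_at_right_field flat_exp_def field_simps intro!: exI[of _ 1])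
      ultimately show ?thesis by (rule Lim_transform_eventually)
    qed
    moreover have "((\<lambda>h. flat_exp p h / h) \<longlongrightarrow> 0) (at_left 0)"
    proof (rule Lim_transform_eventually[OF tendsto_const])
      show "\<forall>\<^sub>F h in at_left 0. 0 = flat_exp p h / h"
        by (auto simp: eventually_at_left_field flat_exp_def intro!: exI[of _ "-1"])
    qed
    ultimately have "((\<lambda>h. flat_exp p h / h) \<longlongrightarrow> 0) (at 0)"
      by (simp add: filterlim_split_at)
    then show ?thesis using 2
      by (simp add: DERIV_def flat_exp_def)
  next
    case 3
    have "((\<lambda>s. poly p (1 / s) * exp (- 1 / s)) has_real_derivative
        poly ([:0, 0, 1:] * (p - pderiv p)) (1 / s) * exp (- 1 / s)) (at s)"
      using 3 by (auto intro!: derivative_eq_intros DERIV_chain2[OF poly_DERIV]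
          simp: field_simps power2_eq_square)
    then have "(flat_exp p has_real_derivative
        poly ([:0, 0, 1:] * (p - pderiv p)) (1 / s) * exp (- 1 / s)) (at s)"
      by (rule has_field_derivative_transform_within_open[where S="{0<..}"])
         (use 3 in \<open>auto simp: flat_exp_def\<close>)
    then show ?thesis using 3 by (simp add: flat_exp_def)
  qed
qed

text \<open>A class closed under directional derivatives by its generation rules, so that smoothness
  follows by induction on the order without computing higher derivatives. The polynomial in
  \<open>bump\<close> is arbitrary because differentiation changes it.\<close>

inductive bump_algebra :: "('a::euclidean_space \<Rightarrow> real) \<Rightarrow> bool" where
  const: "bump_algebra (\<lambda>_. c)"
| linear: "bump_algebra (\<lambda>x. x \<bullet> v)"
| bump: "bump_algebra (\<lambda>x. flat_exp p (c - x \<bullet> x))"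
| add: "bump_algebra f \<Longrightarrow> bump_algebra g \<Longrightarrow> bump_algebra (\<lambda>x. f x + g x)"
| mult: "bump_algebra f \<Longrightarrow> bump_algebra g \<Longrightarrow> bump_algebra (\<lambda>x. f x * g x)"

lemma bump_algebra_has_derivative:
  "bump_algebra f \<Longrightarrow> \<exists>f'. (\<forall>x. (f has_derivative f' x) (at x)) \<and> (\<forall>v. bump_algebra (\<lambda>x. f' x v))"
proof (induction rule: bump_algebra.induct)
  case (const c)
  show ?case
    by (rule exI[of _ "\<lambda>_ _. 0"]) (auto intro: bump_algebra.const)
next
  case (linear v)
  show ?case
    by (rule exI[of _ "\<lambda>_ w. w \<bullet> v"])
       (auto intro: bump_algebra.const bounded_linear_imp_has_derivative bounded_linear_inner_left)
next
  case (bump p c)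
  let ?q = "[:0, 0, 1:] * (p - pderiv p)"
  have "((\<lambda>x. flat_exp p (c - x \<bullet> x)) has_derivative
      (\<lambda>v. flat_exp ?q (c - x \<bullet> x) * ((-2) * (x \<bullet> v)))) (at x)" for x :: 'a
    by (rule has_derivative_compose[OF _ has_real_derivative_flat_exp[unfolded has_field_derivative_def],
          where f="\<lambda>x. c - x \<bullet> x", THEN has_derivative_eq_rhs])
       (auto intro!: derivative_eq_intros simp: inner_commute)
  moreover have "bump_algebra (\<lambda>x. flat_exp ?q (c - x \<bullet> x) * ((-2) * (x \<bullet> v)))" for v :: 'a
    by (intro bump_algebra.intros)
  ultimately show ?case
    by (intro exI[of _ "\<lambda>x v. flat_exp ?q (c - x \<bullet> x) * ((-2) * (x \<bullet> v))"]) blast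
next
  case (add f g)
  then obtain f' g' where
    "\<forall>x. (f has_derivative f' x) (at x)" "\<forall>v. bump_algebra (\<lambda>x. f' x v)"
    "\<forall>x. (g has_derivative g' x) (at x)" "\<forall>v. bump_algebra (\<lambda>x. g' x v)" by blast
  then show ?case
    by (intro exI[of _ "\<lambda>x v. f' x v + g' x v"]) (auto intro: has_derivative_add bump_algebra.add)
next
  case (mult f g)
  then obtain f' g' where
    "\<forall>x. (f has_derivative f' x) (at x)" "\<forall>v. bump_algebra (\<lambda>x. f' x v)"
    "\<forall>x. (g has_derivative g' x) (at x)" "\<forall>v. bump_algebra (\<lambda>x. g' x v)" by blast
  with mult.hyps show ?case
    by (intro exI[of _ "\<lambda>x v. f x * g' x v + f' x v * g x"])
       (auto intro: has_derivative_mult intro!: bump_algebra.add bump_algebra.mult)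
qed

lemma bump_algebra_Ck: "bump_algebra f \<Longrightarrow> Ck_on_space k f"
proof (induction k arbitrary: f)
  case 0
  then obtain f' where "\<forall>x. (f has_derivative f' x) (at x)"
    using bump_algebra_has_derivative by blast
  then show ?case
    by (auto simp: continuous_on_eq_continuous_at intro: has_derivative_continuous)
next
  case (Suc k)
  then obtain f' where f': "\<forall>x. (f has_derivative f' x) (at x)" "\<forall>v. bump_algebra (\<lambda>x. f' x v)"
    using bump_algebra_has_derivative by blast
  then have "frechet_derivative f (at x) = f' x" for x
    using frechet_derivative_at by metis
  with f' Suc.IH show ?case by (auto simp: differentiable_def)
qed

lemma real_polynomial_function_bump_algebra:
  fixes f :: "'a::euclidean_space \<Rightarrow> real"
  shows "real_polynomial_function f \<Longrightarrow> bump_algebra f"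
proof (induction rule: real_polynomial_function.induct)
  case (linear f)
  then interpret bounded_linear f .
  have "f x = x \<bullet> (\<Sum>b\<in>Basis. f b *\<^sub>R b)" for x
  proof -
    have "f x = f (\<Sum>b\<in>Basis. (x \<bullet> b) *\<^sub>R b)" by (simp add: euclidean_representation)
    also have "\<dots> = x \<bullet> (\<Sum>b\<in>Basis. f b *\<^sub>R b)"
      by (simp add: sum scaleR inner_sum_right mult.commute)
    finally show ?thesis .
  qed
  then have "f = (\<lambda>x. x \<bullet> (\<Sum>b\<in>Basis. f b *\<^sub>R b))" by (rule ext)
  then show ?case using bump_algebra.linear by metis
qed (auto intro: bump_algebra.intros)

text \<open>Multiplying a Stone--Weierstrass approximation of \<open>h / b\<close> by the bump \<open>b\<close> approximates \<open>h\<close>;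
  since \<open>b \<le> 1\<close> the error does not grow, and no plateau function is needed.\<close>

lemma compact_support_approx:
  fixes h :: "'a::euclidean_space \<Rightarrow> real"
  assumes h: "continuous_on UNIV h" and r: "\<And>x. r \<le> norm x \<Longrightarrow> h x = 0" "0 < r" and e: "0 < e"
  obtains g where "smooth_compact_support g" "\<And>x. \<bar>g x - h x\<bar> < e"
proof -
  define R where "R = r + 1"
  define b where "b = (\<lambda>x::'a. flat_exp 1 (R\<^sup>2 - x \<bullet> x))"
  have R: "0 < R" "r < R" using r by (auto simp: R_def)
  have b_pos: "0 < b x \<longleftrightarrow> norm x < R" for x
    using R by (auto simp: b_def flat_exp_def power2_norm_eq_inner[symmetric] abs_square_less_1
        intro: power_strict_mono power2_less_imp_less)
  have b_zero: "b x = 0 \<longleftrightarrow> R \<le> norm x" for x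
    using b_pos[of x] by (auto simp: b_def flat_exp_def split: if_splits)
  have b_nonneg: "0 \<le> b x" and b_le: "b x \<le> 1" for x by (auto simp: b_def flat_exp_def)
  have b_alg: "bump_algebra b" unfolding b_def by (rule bump_algebra.bump)
  then have b_cont: "continuous_on UNIV b" using bump_algebra_Ck[of b 0] by simp
  have "continuous_on (cball 0 R) (\<lambda>x. h x / b x)"
  proof -
    \<comment> \<open>On the sphere of radius \<open>R\<close> the quotient has denominator 0 and
      evaluates to 0. The gap between \<open>r\<close> and \<open>R\<close> makes this agree with
      the values nearby, so two open pieces suffice.\<close>
    have "continuous_on (ball 0 R \<union> - cball 0 r) (\<lambda>x. h x / b x)"
    proof (rule continuous_on_open_Un)
      show "continuous_on (ball 0 R) (\<lambda>x. h x / b x)"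
        by (intro continuous_intros continuous_on_subset[OF h] continuous_on_subset[OF b_cont])
           (auto simp: b_zero)
      have "h x / b x = 0" if "x \<in> - cball 0 r" for x using that r by auto
      then show "continuous_on (- cball 0 r) (\<lambda>x. h x / b x)"
        using continuous_on_cong[of "- cball 0 r" _ "\<lambda>x. h x / b x" "\<lambda>_. 0"] by simp
    qed auto
    then show ?thesis by (rule continuous_on_subset) (use R in auto)
  qed
  then obtain p where p: "real_polynomial_function p" "\<And>x. x \<in> cball 0 R \<Longrightarrow> \<bar>h x / b x - p x\<bar> < e"
    using Stone_Weierstrass_real_polynomial_function[of "cball 0 R" "\<lambda>x. h x / b x" e] e
    by auto
  define g where "g = (\<lambda>x. b x * p x)"
  have "bump_algebra g" unfolding g_def
    by (intro bump_algebra.mult b_alg real_polynomial_function_bump_algebra p)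
  moreover have "compact (closure {x. g x \<noteq> 0})"
  proof -
    have "{x. g x \<noteq> 0} \<subseteq> cball 0 R" by (auto simp: g_def b_zero)
    then have "bounded {x. g x \<noteq> 0}" by (rule bounded_subset[rotated]) auto
    then show ?thesis by simp
  qed
  ultimately have "smooth_compact_support g"
    by (simp add: smooth_compact_support_def bump_algebra_Ck)
  moreover have "\<bar>g x - h x\<bar> < e" for x
  proof (cases "norm x < R")
    case True
    then have "0 < b x" by (simp add: b_pos)
    then have "g x - h x = b x * (p x - h x / b x)" by (simp add: g_def field_simps)
    then have "\<bar>g x - h x\<bar> = b x * \<bar>h x / b x - p x\<bar>"
      using \<open>0 < b x\<close> by (simp add: abs_mult abs_minus_commute)
    also have "\<dots> \<le> 1 * \<bar>h x / b x - p x\<bar>" by (intro mult_right_mono b_le) auto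
    also have "\<dots> < e" using p(2)[of x] True by simp
    finally show ?thesis .
  next
    case False
    then have "b x = 0" using b_zero by simp
    then show ?thesis using False r R e by (simp add: g_def)
  qed
  ultimately show ?thesis using that by blast
qed

text \<open>A continuous cutoff at a large radius costs little in sup norm because \<open>f\<close>
  is small there; \<open>compact_support_approx\<close> then smooths the compactly supported result.
  Boundedness of \<open>f\<close>, needed to form \<open>Bcontfun f\<close>, comes from a single
  approximant at distance below 1.\<close>

lemma vanishing_at_infinity_C0:
  fixes f :: "real^'n \<Rightarrow> real"
  assumes f: "continuous_on UNIV f" "(f \<longlongrightarrow> 0) at_infinity"
  shows "f \<in> C0"
proof -
  have small: "\<exists>r>0. \<forall>x. r \<le> norm x \<longrightarrow> \<bar>f x\<bar> < e" if e: "0 < e" for e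
  proof -
    obtain b where "\<forall>x. b \<le> norm x \<longrightarrow> \<bar>f x\<bar> < e"
      using tendstoD[OF f(2) e] by (auto simp: eventually_at_infinity dist_real_def)
    then show ?thesis by (intro exI[of _ "max b 1"]) auto
  qed
  have approx: "\<exists>g. smooth_compact_support g \<and> (\<forall>x. \<bar>g x - f x\<bar> < e)" if "0 < e" for e
  proof -
    obtain r where r: "0 < r" "\<forall>x. r \<le> norm x \<longrightarrow> \<bar>f x\<bar> < e / 2" using small[of "e / 2"] \<open>0 < e\<close> by auto
    define h where "h = (\<lambda>x. f x * max 0 (min 1 (r + 1 - norm x)))"
    have "continuous_on UNIV h" unfolding h_def by (intro continuous_intros f)
    moreover have "h x = 0" if "r + 1 \<le> norm x" for x using that by (simp add: h_def)
    ultimately obtain g where g: "smooth_compact_support g" "\<And>x. \<bar>g x - h x\<bar> < e / 2"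
      using compact_support_approx[of h "r + 1" "e / 2"] r \<open>0 < e\<close> by auto
    have "\<bar>h x - f x\<bar> \<le> e / 2" for x
    proof (cases "r \<le> norm x")
      case True
      let ?m = "max 0 (min 1 (r + 1 - norm x))"
      have "h x - f x = f x * (?m - 1)" by (simp add: h_def algebra_simps)
      then have "\<bar>h x - f x\<bar> = \<bar>f x\<bar> * \<bar>?m - 1\<bar>" by (simp add: abs_mult)
      also have "\<dots> \<le> \<bar>f x\<bar> * 1" by (intro mult_left_mono) auto
      also have "\<dots> \<le> e / 2" using r True by (simp add: less_imp_le)
      finally show ?thesis .
    next
      case False
      then show ?thesis using \<open>0 < e\<close> by (simp add: h_def)
    qed
    with g have "\<bar>g x - f x\<bar> < e" for x
      using g(2)[of x] by (smt (verit) field_sum_of_halves)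
    with g show ?thesis by blast
  qed
  have cpt_bc: "g \<in> bcontfun" if "smooth_compact_support g" for g :: "real^'n \<Rightarrow> real"
  proof -
    have "continuous_on UNIV g"
      using that unfolding smooth_compact_support_def by (metis Ck_on_space.simps(1))
    moreover have "bounded (range g)"
    proof -
      have "compact (g ` closure {x. g x \<noteq> 0})"
        using that calculation unfolding smooth_compact_support_def
        by (intro compact_continuous_image) (auto intro: continuous_on_subset)
      then have "bounded (insert 0 (g ` closure {x. g x \<noteq> 0}))" by (simp add: compact_imp_bounded)
      moreover have "range g \<subseteq> insert 0 (g ` closure {x. g x \<noteq> 0})"
        using closure_subset by fastforce
      ultimately show ?thesis by (rule bounded_subset)
    qed
    ultimately show ?thesis by (simp add: bcontfun_def)
  qed
  obtain g0 where g0: "smooth_compact_support g0" "\<And>x. \<bar>g0 x - f x\<bar> < 1" using approx[of 1] by auto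
  have "bounded (range f)"
  proof -
    obtain B where B: "\<And>x. \<bar>g0 x\<bar> \<le> B" using cpt_bc[OF g0(1)] by (auto simp: bcontfun_def bounded_iff)
    then have "\<bar>f x\<bar> \<le> B + 1" for x
      using g0(2)[of x] B[of x] by (smt (verit))
    then show ?thesis by (auto simp: bounded_iff)
  qed
  then have fbc: "f \<in> bcontfun" using f by (simp add: bcontfun_def)
  have "Bcontfun f \<in> closure {\<phi>. smooth_compact_support (apply_bcontfun \<phi>)}"
    unfolding closure_approachable
  proof (intro allI impI)
    fix e :: real assume "0 < e"
    then obtain g where g: "smooth_compact_support g" "\<And>x. \<bar>g x - f x\<bar> < e / 2"
      using approx[of "e / 2"] by auto
    have "dist (Bcontfun g) (Bcontfun f) \<le> e / 2"
      using cpt_bc[OF g(1)] fbc g(2)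
      by (intro dist_bound) (auto simp: Bcontfun_inverse dist_real_def less_imp_le)
    then show "\<exists>\<phi>\<in>{\<phi>. smooth_compact_support (apply_bcontfun \<phi>)}. dist \<phi> (Bcontfun f) < e"
      using g(1) cpt_bc[OF g(1)] \<open>0 < e\<close> by (intro bexI[of _ "Bcontfun g"]) (auto simp: Bcontfun_inverse)
  qed
  then show ?thesis unfolding C0_def
    by (intro image_eqI[of _ _ "Bcontfun f"]) (use fbc in \<open>auto simp: Bcontfun_inverse\<close>)
qed

section \<open>Gaussian integrals with a singular weight\<close>

lemma nn_integral_powr_from_0:
  fixes a c :: real
  assumes "-1 < a" "0 \<le> c"
  shows "(\<integral>\<^sup>+x. ennreal (indicator {0..c} x * x powr a) \<partial>lborel) = ennreal (c powr (a + 1) / (a + 1))"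
proof (rule nn_integral_has_integral_lborel)
  have "((\<lambda>x. if x \<in> {0..c} then x powr a else 0) has_integral c powr (a + 1) / (a + 1)) UNIV"
    by (subst has_integral_restrict_UNIV) (rule has_integral_powr_from_0[OF assms])
  then show "((\<lambda>x. indicator {0..c} x * x powr a) has_integral c powr (a + 1) / (a + 1)) UNIV"
    by (rule has_integral_eq[rotated]) (auto simp: indicator_def)
qed auto

lemma has_bochner_integral_powr_from_0:
  fixes a c :: real
  assumes "-1 < a" "0 \<le> c"
  shows "has_bochner_integral lborel (\<lambda>x. indicator {0<..<c} x * x powr a) (c powr (a + 1) / (a + 1))"
proof -
  have "has_bochner_integral lborel (\<lambda>x. indicator {0..c} x * x powr a) (c powr (a + 1) / (a + 1))"
    using nn_integral_powr_from_0[OF assms] assms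
    by (intro has_bochner_integral_nn_integral) auto
  moreover have "AE x in lborel. indicator {0..c} x * x powr a = indicator {0<..<c} x * x powr a"
    using AE_lborel_singleton[of 0] AE_lborel_singleton[of c]
    by eventually_elim (auto simp: indicator_def)
  ultimately show ?thesis by (subst has_bochner_integral_cong_AE[symmetric]) auto
qed

lemma nn_integral_gauss_finite: "(\<integral>\<^sup>+x. ennreal (exp (- x\<^sup>2 / 4)) \<partial>lborel) < \<infinity>"
proof -
  have "integrable lborel (normal_density 0 (sqrt 2))" by simp
  then have "integrable lborel (\<lambda>x. sqrt (4 * pi) * normal_density 0 (sqrt 2) x)" by simp
  also have "(\<lambda>x. sqrt (4 * pi) * normal_density 0 (sqrt 2) x) = (\<lambda>x. exp (- x\<^sup>2 / 4))"
    by (auto simp: normal_density_def fun_eq_iff)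
  finally show ?thesis
    by (auto simp: integrable_iff_bounded)
qed

text \<open>Where |x + z| > 1 the weight is at most 1; where it is at most 1 the Gaussian is at most
  1 and the weight has a translation-invariant finite integral because \<open>\<alpha> < 1\<close>.
  Hence a bound uniform in \<open>x\<close>.\<close>

lemma nn_integral_gauss_weight_real:
  fixes \<alpha> :: real
  assumes "0 \<le> \<alpha>" "\<alpha> < 1"
  shows "\<exists>K\<ge>0. \<forall>x.
    (\<integral>\<^sup>+z. ennreal (exp (- z\<^sup>2 / 4) * \<bar>x + z\<bar> powr (- \<alpha>)) \<partial>lborel) \<le> ennreal K"
proof -
  obtain G where G: "0 \<le> G" "(\<integral>\<^sup>+x. ennreal (exp (- x\<^sup>2 / 4)) \<partial>lborel) = ennreal G"
    using nn_integral_gauss_finite by (auto simp: less_top_ennreal)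
  define P :: "real \<Rightarrow> real" where "P = (\<lambda>s. indicator {0..1} s * s powr (- \<alpha>))"
  have P: "(\<integral>\<^sup>+s. ennreal (P s) \<partial>lborel) = ennreal (1 / (1 - \<alpha>))"
    using nn_integral_powr_from_0[of "-\<alpha>" 1] assms by (simp add: P_def)
  have [measurable]: "P \<in> borel_measurable borel" by (simp add: P_def)
  have P0: "0 \<le> P s" for s by (simp add: P_def)
  have "(\<integral>\<^sup>+z. ennreal (exp (- z\<^sup>2 / 4) * \<bar>x + z\<bar> powr (- \<alpha>)) \<partial>lborel)
      \<le> ennreal (G + 2 / (1 - \<alpha>))" for x
  proof -
    have le: "exp (- z\<^sup>2 / 4) * \<bar>x + z\<bar> powr (- \<alpha>) \<le> exp (- z\<^sup>2 / 4) + P (x + z) + P (- x - z)" for z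
    proof (cases "\<bar>x + z\<bar> \<le> 1")
      case True
      have "exp (- z\<^sup>2 / 4) * \<bar>x + z\<bar> powr (- \<alpha>) \<le> 1 * \<bar>x + z\<bar> powr (- \<alpha>)"
        by (intro mult_right_mono) auto
      also have "\<dots> \<le> P (x + z) + P (- x - z)"
        using True by (cases "0 \<le> x + z") (auto simp: P_def indicator_def)
      finally show ?thesis by (simp add: add.assoc add_increasing)
    next
      case False
      then have "\<bar>x + z\<bar> powr (- \<alpha>) \<le> 1"
        using assms powr_mono2'[of "-\<alpha>" 1 "\<bar>x + z\<bar>"] by simp
      then have "exp (- z\<^sup>2 / 4) * \<bar>x + z\<bar> powr (- \<alpha>) \<le> exp (- z\<^sup>2 / 4) * 1"
        by (intro mult_left_mono) auto
      then show ?thesis using P0[of "x + z"] P0[of "- x - z"] by linarith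
    qed
    have "(\<integral>\<^sup>+z. ennreal (exp (- z\<^sup>2 / 4) * \<bar>x + z\<bar> powr (- \<alpha>)) \<partial>lborel)
        \<le> (\<integral>\<^sup>+z. (ennreal (exp (- z\<^sup>2 / 4)) + ennreal (P (x + z))) + ennreal (P (- x - z)) \<partial>lborel)"
      by (intro nn_integral_mono) (use le P0 in \<open>simp flip: ennreal_plus\<close>)
    also have "\<dots> = ennreal G + (\<integral>\<^sup>+z. ennreal (P (x + z)) \<partial>lborel) + (\<integral>\<^sup>+z. ennreal (P (- x - z)) \<partial>lborel)"
      by (subst nn_integral_add; simp add: nn_integral_add G(2)[simplified])
    also have "(\<integral>\<^sup>+z. ennreal (P (x + z)) \<partial>lborel) = ennreal (1 / (1 - \<alpha>))"
      using nn_integral_real_affine[of "\<lambda>s. ennreal (P s)" 1 x] P by simp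
    also have "(\<integral>\<^sup>+z. ennreal (P (- x - z)) \<partial>lborel) = ennreal (1 / (1 - \<alpha>))"
      using nn_integral_real_affine[of "\<lambda>s. ennreal (P s)" "-1" "-x"] P by simp
    also have "ennreal G + ennreal (1 / (1 - \<alpha>)) + ennreal (1 / (1 - \<alpha>)) = ennreal (G + 2 / (1 - \<alpha>))"
      using G assms by (simp flip: ennreal_plus)
    finally show ?thesis .
  qed
  moreover have "0 \<le> G + 2 / (1 - \<alpha>)" using G assms by simp
  ultimately show ?thesis by blast
qed

text \<open>\<open>0 powr (- \<alpha>)\<close> evaluates to 0, so bounding the weight by a product
  over coordinates can fail where a coordinate of \<open>x + z\<close> vanishes. These hyperplanes
  are null sets.\<close>

lemma AE_coordinates_nonzero:
  fixes x :: "'a::euclidean_space"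
  shows "AE z in lborel. \<forall>b\<in>Basis. (x + z) \<bullet> b \<noteq> 0"
proof -
  have "AE z in lborel. (x + z) \<bullet> b \<noteq> 0" if "b \<in> Basis" for b :: 'a
  proof -
    have "{z. z \<bullet> b = - (x \<bullet> b)} \<in> null_sets lebesgue"
      using negligible_standard_hyperplane[OF that] negligible_iff_null_sets by blast
    moreover have "{z. z \<bullet> b = - (x \<bullet> b)} \<in> sets lborel" by simp
    ultimately have "{z. z \<bullet> b = - (x \<bullet> b)} \<in> null_sets lborel"
      using null_sets_completion_iff by blast
    then have "AE z in lborel. z \<notin> {z. z \<bullet> b = - (x \<bullet> b)}" by (rule AE_not_in)
    then show ?thesis by eventually_elim (auto simp: inner_add_left)
  qed
  then show ?thesis by (subst AE_ball_countable) (auto intro: countable_finite)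
qed

lemma prod_mono_ennreal:
  fixes f g :: "'a \<Rightarrow> ennreal"
  shows "(\<And>i. i \<in> A \<Longrightarrow> f i \<le> g i) \<Longrightarrow> prod f A \<le> prod g A"
  by (induction A rule: infinite_finite_induct) (auto intro: mult_mono)

text \<open>The weight is dominated by a product of one-dimensional weights, because
  \<open>\<bar>z \<bullet> b\<bar> \<le> norm z\<close> for every coordinate.\<close>

lemma gauss_weight_bound:
  fixes \<gamma> :: real
  assumes "0 \<le> \<gamma>" "\<gamma> < DIM('a::euclidean_space)"
  shows "\<exists>K>0. \<forall>x::'a.
    integrable lborel (\<lambda>z. exp (- (norm z)\<^sup>2 / 4) * norm (x + z) powr (- \<gamma>)) \<and>
    (LINT z|lborel. exp (- (norm z)\<^sup>2 / 4) * norm (x + z) powr (- \<gamma>)) \<le> K"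
proof -
  \<comment> \<open>Splitting the exponent evenly over the coordinates makes every factor integrable
    precisely under \<open>\<gamma> < DIM('a)\<close>.\<close>
  define \<alpha> where "\<alpha> = \<gamma> / DIM('a)"
  have \<alpha>: "0 \<le> \<alpha>" "\<alpha> < 1" using assms by (auto simp: \<alpha>_def)
  from nn_integral_gauss_weight_real[OF \<alpha>] obtain k where k: "0 \<le> k"
    "\<And>x. (\<integral>\<^sup>+z. ennreal (exp (- z\<^sup>2 / 4) * \<bar>x + z\<bar> powr (- \<alpha>)) \<partial>lborel) \<le> ennreal k" by blast
  have le: "exp (- (norm z)\<^sup>2 / 4) * norm (x + z) powr (- \<gamma>)
      \<le> (\<Prod>b\<in>Basis. exp (- (z \<bullet> b)\<^sup>2 / 4) * \<bar>x \<bullet> b + z \<bullet> b\<bar> powr (- \<alpha>))"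
    if nz: "\<forall>b\<in>Basis. (x + z) \<bullet> b \<noteq> 0" for x z :: 'a
  proof -
    have "- (norm z)\<^sup>2 / 4 = (\<Sum>b\<in>Basis. - (z \<bullet> b)\<^sup>2 / 4)"
      by (subst power2_norm_eq_inner, subst euclidean_inner)
         (simp add: power2_eq_square sum_negf flip: sum_divide_distrib)
    then have "exp (- (norm z)\<^sup>2 / 4) = (\<Prod>b\<in>Basis. exp (- (z \<bullet> b)\<^sup>2 / 4))"
      by (simp add: exp_sum)
    moreover have "norm (x + z) powr (- \<gamma>) \<le> (\<Prod>b\<in>Basis. \<bar>x \<bullet> b + z \<bullet> b\<bar> powr (- \<alpha>))"
    proof -
      have "x + z \<noteq> 0" using nz nonempty_Basis by fastforce
      then have "norm (x + z) powr (- \<gamma>) = (norm (x + z) powr (- \<alpha>)) ^ DIM('a)"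
        using \<open>x + z \<noteq> 0\<close> by (subst powr_power) (auto simp: \<alpha>_def)
      also have "\<dots> = (\<Prod>b\<in>(Basis::'a set). norm (x + z) powr (- \<alpha>))" by simp
      also have "\<dots> \<le> (\<Prod>b\<in>Basis. \<bar>x \<bullet> b + z \<bullet> b\<bar> powr (- \<alpha>))"
      proof (rule prod_mono, intro conjI)
        fix b :: 'a assume b: "b \<in> Basis"
        then have "0 < \<bar>(x + z) \<bullet> b\<bar>" "\<bar>(x + z) \<bullet> b\<bar> \<le> norm (x + z)"
          using nz Basis_le_norm by auto
        then show "norm (x + z) powr (- \<alpha>) \<le> \<bar>x \<bullet> b + z \<bullet> b\<bar> powr (- \<alpha>)"
          using \<alpha> by (simp add: powr_mono2' inner_add_left)
      qed simp
      finally show ?thesis .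
    qed
    ultimately show ?thesis by (simp add: prod.distrib mult_left_mono prod_nonneg)
  qed
  have nn: "(\<integral>\<^sup>+z. ennreal (exp (- (norm z)\<^sup>2 / 4) * norm (x + z) powr (- \<gamma>)) \<partial>lborel)
      \<le> ennreal (k ^ DIM('a))" for x :: 'a
  proof -
    have "(\<integral>\<^sup>+z. ennreal (exp (- (norm z)\<^sup>2 / 4) * norm (x + z) powr (- \<gamma>)) \<partial>lborel)
      \<le> (\<integral>\<^sup>+z. (\<Prod>b\<in>Basis. ennreal (exp (- (z \<bullet> b)\<^sup>2 / 4) * \<bar>x \<bullet> b + z \<bullet> b\<bar> powr (- \<alpha>))) \<partial>lborel)"
    proof (rule nn_integral_mono_AE)
      show "AE z in lborel. ennreal (exp (- (norm z)\<^sup>2 / 4) * norm (x + z) powr (- \<gamma>))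
          \<le> (\<Prod>b\<in>Basis. ennreal (exp (- (z \<bullet> b)\<^sup>2 / 4) * \<bar>x \<bullet> b + z \<bullet> b\<bar> powr (- \<alpha>)))"
        using AE_coordinates_nonzero[of x]
        by eventually_elim (subst prod_ennreal, simp, rule ennreal_leI, rule le)
    qed
    also have "\<dots> = (\<Prod>b\<in>Basis. \<integral>\<^sup>+z. ennreal (exp (- z\<^sup>2 / 4) * \<bar>x \<bullet> b + z\<bar> powr (- \<alpha>)) \<partial>lborel)"
      by (rule nn_integral_lborel_prod) auto
    also have "\<dots> \<le> (\<Prod>b\<in>(Basis::'a set). ennreal k)"
      by (intro prod_mono_ennreal k)
    also have "\<dots> = ennreal (k ^ DIM('a))" using k by (simp add: ennreal_power)
    finally show ?thesis .
  qed
  have int: "integrable lborel (\<lambda>z. exp (- (norm z)\<^sup>2 / 4) * norm (x + z) powr (- \<gamma>))" for x :: 'a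
    using le_less_trans[OF nn[of x] ennreal_less_top]
    by (intro integrableI_bounded) auto
  have "(LINT z|lborel. exp (- (norm z)\<^sup>2 / 4) * norm (x + z) powr (- \<gamma>)) \<le> k ^ DIM('a) + 1" for x :: 'a
  proof -
    have "ennreal (LINT z|lborel. exp (- (norm z)\<^sup>2 / 4) * norm (x + z) powr (- \<gamma>)) \<le> ennreal (k ^ DIM('a))"
      using nn[of x] nn_integral_eq_integral[OF int[of x]] by simp
    then show ?thesis using k by (subst (asm) ennreal_le_iff) auto
  qed
  then show ?thesis using int k by (intro exI[of _ "k ^ DIM('a) + 1"]) (simp add: add_nonneg_pos)
qed

text \<open>The weight is homogeneous: \<open>x + s *\<^sub>R z\<close> is \<open>s\<close> times
  \<open>x /\<^sub>R s + z\<close>. The shifted centre does no harm because the unscaled bound is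
  uniform in it.\<close>

lemma gauss_weight_bound_scaled:
  fixes \<gamma> :: real
  assumes "0 \<le> \<gamma>" "\<gamma> < DIM('a::euclidean_space)"
  shows "\<exists>K>0. \<forall>(x::'a) s. 0 < s \<longrightarrow>
    integrable lborel (\<lambda>z. exp (- (norm z)\<^sup>2 / 4) * norm (x + s *\<^sub>R z) powr (- \<gamma>)) \<and>
    (LINT z|lborel. exp (- (norm z)\<^sup>2 / 4) * norm (x + s *\<^sub>R z) powr (- \<gamma>)) \<le> K * s powr (- \<gamma>)"
proof -
  obtain K where K: "0 < K"
    "\<And>x::'a. integrable lborel (\<lambda>z. exp (- (norm z)\<^sup>2 / 4) * norm (x + z) powr (- \<gamma>))"
    "\<And>x::'a. (LINT z|lborel. exp (- (norm z)\<^sup>2 / 4) * norm (x + z) powr (- \<gamma>)) \<le> K"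
    using gauss_weight_bound[OF assms] by blast
  have eq: "exp (- (norm z)\<^sup>2 / 4) * norm (x + s *\<^sub>R z) powr (- \<gamma>)
      = s powr (- \<gamma>) * (exp (- (norm z)\<^sup>2 / 4) * norm (x /\<^sub>R s + z) powr (- \<gamma>))"
    if "0 < s" for x z :: 'a and s
  proof -
    have "x + s *\<^sub>R z = s *\<^sub>R (x /\<^sub>R s + z)" using that by (simp add: scaleR_add_right)
    then have "norm (x + s *\<^sub>R z) = s * norm (x /\<^sub>R s + z)" using that by simp
    then show ?thesis using that by (simp add: powr_mult)
  qed
  show ?thesis
  proof (intro exI[of _ K] conjI allI impI K(1))
    fix x :: 'a and s :: real assume s: "0 < s"
    show "integrable lborel (\<lambda>z. exp (- (norm z)\<^sup>2 / 4) * norm (x + s *\<^sub>R z) powr (- \<gamma>))"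
      unfolding eq[OF s] using K(2) by simp
    show "(LINT z|lborel. exp (- (norm z)\<^sup>2 / 4) * norm (x + s *\<^sub>R z) powr (- \<gamma>)) \<le> K * s powr (- \<gamma>)"
      unfolding eq[OF s] using mult_left_mono[OF K(3), of "s powr (- \<gamma>)"] by (simp add: mult.commute)
  qed
qed

lemma integrable_gauss: "integrable lborel (\<lambda>z::'a::euclidean_space. exp (- (norm z)\<^sup>2 / 4))"
proof -
  have "integrable lborel (\<lambda>z::'a. exp (- (norm z)\<^sup>2 / 4) * norm (0 + z) powr (- 0))"
    using gauss_weight_bound[OF order_refl, where 'a='a] DIM_positive by fastforce
  \<comment> \<open>\<open>0 powr 0\<close> is 0, so the two integrands differ at the
    origin.\<close>
  moreover have "AE z::'a in lborel. exp (- (norm z)\<^sup>2 / 4) * norm (0 + z) powr (- 0) = exp (- (norm z)\<^sup>2 / 4)"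
    using AE_lborel_singleton[of 0] by eventually_elim auto
  ultimately show ?thesis by (subst integrable_cong_AE[symmetric]) auto
qed

section \<open>The weighted heat semigroup in rescaled variables\<close>

lemma lborel_integral_affine:
  fixes f :: "'a::euclidean_space \<Rightarrow> real"
  assumes [measurable]: "f \<in> borel_measurable borel" and c: "c \<noteq> 0"
  shows "(LINT y|lborel. f y) = \<bar>c\<bar> ^ DIM('a) * (LINT z|lborel. f (x + c *\<^sub>R z))"
  by (subst lborel_affine[OF c, of x]) (simp add: integral_density integral_distr)

text \<open>The substitution \<open>y = x + sqrt \<tau> *\<^sub>R z\<close> frees the Gaussian from
  \<open>x\<close> and \<open>\<tau>\<close>; its Jacobian cancels the time dependence of the
  normalizing factor. Later estimates of the weighted semigroup are made in this form.\<close>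

lemma heat_semigroup_weighted_eq:
  fixes \<phi> :: "real^'n \<Rightarrow> real"
  assumes [measurable]: "\<phi> \<in> borel_measurable borel" and \<tau>: "0 < \<tau>"
  shows "heat_semigroup_weighted \<gamma> \<tau> \<phi> x = (4 * pi) powr (- real CARD('n) / 2) *
     (LINT z|lborel. exp (- (norm z)\<^sup>2 / 4) * norm (x + sqrt \<tau> *\<^sub>R z) powr (- \<gamma>) * \<phi> (x + sqrt \<tau> *\<^sub>R z))"
proof -
  have "(LINT y|lborel. exp (- (norm (x - y))\<^sup>2 / (4 * \<tau>)) * norm y powr (- \<gamma>) * \<phi> y) =
     sqrt \<tau> ^ CARD('n) * (LINT z|lborel. exp (- (norm z)\<^sup>2 / 4) * norm (x + sqrt \<tau> *\<^sub>R z) powr (- \<gamma>) * \<phi> (x + sqrt \<tau> *\<^sub>R z))"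
    using \<tau> by (subst lborel_integral_affine[where c="sqrt \<tau>" and x=x]) (auto simp: power_mult_distrib)
  moreover have "(4 * pi * \<tau>) powr (- real CARD('n) / 2) * sqrt \<tau> ^ CARD('n) = (4 * pi) powr (- real CARD('n) / 2)"
  proof -
    have "sqrt \<tau> ^ CARD('n) = \<tau> powr (real CARD('n) / 2)"
      using \<tau> by (simp add: powr_half_sqrt[symmetric] powr_power)
    then show ?thesis using \<tau> by (simp add: powr_mult flip: powr_add)
  qed
  ultimately show ?thesis
    unfolding heat_semigroup_weighted_def by (simp flip: mult.assoc)
qed

lemma integrable_heat_semigroup_weighted:
  fixes \<phi> :: "real^'n \<Rightarrow> real"
  assumes \<gamma>: "0 \<le> \<gamma>" "\<gamma> < real CARD('n)" and \<tau>: "0 < \<tau>"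
    and [measurable]: "\<phi> \<in> borel_measurable borel" and M: "\<And>y. \<bar>\<phi> y\<bar> \<le> M"
  shows "integrable lborel (\<lambda>z. exp (- (norm z)\<^sup>2 / 4) * norm (x + sqrt \<tau> *\<^sub>R z) powr (- \<gamma>) * \<phi> (x + sqrt \<tau> *\<^sub>R z))"
proof (rule Bochner_Integration.integrable_bound)
  have "integrable lborel (\<lambda>z. exp (- (norm z)\<^sup>2 / 4) * norm (x + sqrt \<tau> *\<^sub>R z) powr (- \<gamma>))"
    using gauss_weight_bound_scaled[where 'a="real^'n", of \<gamma>] \<gamma> \<tau> by auto
  then show "integrable lborel (\<lambda>z. exp (- (norm z)\<^sup>2 / 4) * norm (x + sqrt \<tau> *\<^sub>R z) powr (- \<gamma>) * M)"
    by (rule integrable_mult_left)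
  show "AE z in lborel. norm (exp (- (norm z)\<^sup>2 / 4) * norm (x + sqrt \<tau> *\<^sub>R z) powr (- \<gamma>) * \<phi> (x + sqrt \<tau> *\<^sub>R z))
      \<le> norm (exp (- (norm z)\<^sup>2 / 4) * norm (x + sqrt \<tau> *\<^sub>R z) powr (- \<gamma>) * M)"
    using order_trans[OF M abs_ge_self] by (intro AE_I2) (simp add: abs_mult mult_left_mono)
qed auto

text \<open>Both halves of the condition \<open>\<gamma> < min 2 N\<close> originate here:
  \<open>\<gamma> < N\<close> makes the space integral finite, and the resulting rate
  \<open>\<tau> powr (- \<gamma> / 2)\<close> is integrable in time at 0 when
  \<open>\<gamma> < 2\<close>.\<close>

lemma heat_semigroup_weighted_bound:
  fixes \<gamma> :: real
  assumes \<gamma>: "0 \<le> \<gamma>" "\<gamma> < real CARD('n)"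
  shows "\<exists>K>0. \<forall>\<tau>>0. \<forall>\<phi> M. \<forall>x::real^'n. \<phi> \<in> borel_measurable borel \<longrightarrow> (\<forall>y. \<bar>\<phi> y\<bar> \<le> M) \<longrightarrow>
    \<bar>heat_semigroup_weighted \<gamma> \<tau> \<phi> x\<bar> \<le> K * M * \<tau> powr (- \<gamma> / 2)"
proof -
  obtain K where K: "0 < K"
    "\<And>(x::real^'n) s. 0 < s \<Longrightarrow> integrable lborel (\<lambda>z. exp (- (norm z)\<^sup>2 / 4) * norm (x + s *\<^sub>R z) powr (- \<gamma>))"
    "\<And>(x::real^'n) s. 0 < s \<Longrightarrow> (LINT z|lborel. exp (- (norm z)\<^sup>2 / 4) * norm (x + s *\<^sub>R z) powr (- \<gamma>)) \<le> K * s powr (- \<gamma>)"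
    using gauss_weight_bound_scaled[where 'a="real^'n", of \<gamma>] \<gamma> by auto
  let ?c = "(4 * pi) powr (- real CARD('n) / 2)"
  show ?thesis
  proof (intro exI[of _ "?c * K"] conjI allI impI)
    show "0 < ?c * K" using K by simp
    fix \<tau> M :: real and \<phi> :: "real^'n \<Rightarrow> real" and x :: "real^'n"
    assume \<tau>: "0 < \<tau>" and [measurable]: "\<phi> \<in> borel_measurable borel" and M: "\<forall>y. \<bar>\<phi> y\<bar> \<le> M"
    have "\<bar>LINT z|lborel. exp (- (norm z)\<^sup>2 / 4) * norm (x + sqrt \<tau> *\<^sub>R z) powr (- \<gamma>) * \<phi> (x + sqrt \<tau> *\<^sub>R z)\<bar>
      \<le> (LINT z|lborel. exp (- (norm z)\<^sup>2 / 4) * norm (x + sqrt \<tau> *\<^sub>R z) powr (- \<gamma>) * M)"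
      using M \<tau> K by (intro integral_abs_bound_integral integrable_heat_semigroup_weighted[OF \<gamma>])
        (auto simp: abs_mult mult_left_mono)
    also have "\<dots> \<le> K * sqrt \<tau> powr (- \<gamma>) * M"
      using K(3)[of "sqrt \<tau>" x] \<tau> M abs_ge_zero[of "\<phi> 0"] by (auto intro!: mult_right_mono intro: order_trans)
    also have "sqrt \<tau> powr (- \<gamma>) = \<tau> powr (- \<gamma> / 2)"
      using \<tau> by (simp add: powr_half_sqrt[symmetric] powr_powr)
    finally show "\<bar>heat_semigroup_weighted \<gamma> \<tau> \<phi> x\<bar> \<le> ?c * K * M * \<tau> powr (- \<gamma> / 2)"
      using \<tau> by (simp add: heat_semigroup_weighted_eq abs_mult mult_left_mono mult_ac)
  qed
qed

lemma heat_semigroup_weighted_diff: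
  fixes \<phi> \<psi> :: "real^'n \<Rightarrow> real"
  assumes \<gamma>: "0 \<le> \<gamma>" "\<gamma> < real CARD('n)" and \<tau>: "0 < \<tau>"
    and [measurable]: "\<phi> \<in> borel_measurable borel" "\<psi> \<in> borel_measurable borel"
    and M: "\<And>y. \<bar>\<phi> y\<bar> \<le> M" "\<And>y. \<bar>\<psi> y\<bar> \<le> M"
  shows "heat_semigroup_weighted \<gamma> \<tau> \<phi> x - heat_semigroup_weighted \<gamma> \<tau> \<psi> x
    = heat_semigroup_weighted \<gamma> \<tau> (\<lambda>y. \<phi> y - \<psi> y) x"
  using \<tau> integrable_heat_semigroup_weighted[OF \<gamma> \<tau> assms(4) M(1), where x=x] integrable_heat_semigroup_weighted[OF \<gamma> \<tau> assms(5) M(2), where x=x]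
  by (simp add: heat_semigroup_weighted_eq right_diff_distrib)

lemma heat_semigroup_weighted_nonneg:
  assumes "\<And>y. 0 \<le> \<phi> y"
  shows "0 \<le> heat_semigroup_weighted \<gamma> \<tau> \<phi> x"
  unfolding heat_semigroup_weighted_def using assms by (intro mult_nonneg_nonneg integral_nonneg_AE) auto

lemma heat_semigroup_nonneg:
  assumes "\<And>y. 0 \<le> \<phi> y"
  shows "0 \<le> heat_semigroup \<tau> \<phi> x"
  unfolding heat_semigroup_def using assms by (auto intro!: mult_nonneg_nonneg integral_nonneg_AE)

section \<open>The Duhamel term\<close>

text \<open>The properties that the Duhamel estimates need, shared by solutions and by the barrier.
  Joint measurability is required because the space integral must be measurable in the time
  variable; the indicator discards negative times, where curves are arbitrary.\<close>

definition admissible :: "(real \<Rightarrow> real^'n \<Rightarrow> real) \<Rightarrow> bool" where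
  "admissible u \<longleftrightarrow>
     (\<lambda>(t, x). indicator {0..} t * u t x) \<in> borel_measurable borel \<and>
     (\<forall>t\<ge>0. \<forall>x. 0 \<le> u t x) \<and> (\<forall>T. \<exists>M. \<forall>t\<in>{0..T}. \<forall>x. u t x \<le> M)"

section \<open>Regularity of curves in \<open>C0\<close>\<close>

lemma C0_curves_Bcontfun:
  assumes "u \<in> C0_curves" "0 \<le> t"
  shows "apply_bcontfun (Bcontfun (u t)) = u t"
  using assms by (auto simp: C0_curves_def C0_def apply_bcontfun_inverse)

lemma C0_curves_continuous:
  fixes u :: "real \<Rightarrow> real^'n \<Rightarrow> real"
  assumes u: "u \<in> C0_curves"
  shows "continuous_on ({0..} \<times> UNIV) (\<lambda>(t, x). u t x)"
  unfolding continuous_on_def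
proof
  fix p0 :: "real \<times> (real^'n)" assume p0: "p0 \<in> {0..} \<times> UNIV"
  obtain t x where tx: "p0 = (t, x)" by fastforce
  with p0 have t: "t \<in> {0..}" by simp
  let ?F = "at (t, x) within {0..} \<times> UNIV"
  have "continuous_on {0..} (\<lambda>t. Bcontfun (u t))" using u by (simp add: C0_curves_def)
  then have "continuous_on ({0..} \<times> (UNIV :: (real^'n) set)) (\<lambda>p. Bcontfun (u (fst p)))"
    by (rule continuous_on_compose2) (auto intro!: continuous_intros)
  then have 1: "((\<lambda>p. dist (Bcontfun (u (fst p))) (Bcontfun (u t))) \<longlongrightarrow> 0) ?F"
    using t by (auto simp: continuous_on_def tendsto_dist_iff[symmetric])
  have "continuous_on UNIV (u t)"
    using continuous_on_apply_bcontfun[of UNIV "Bcontfun (u t)"] C0_curves_Bcontfun[OF u, of t] t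
    by (simp del: continuous_on_apply_bcontfun)
  then have "continuous_on ({0..} \<times> UNIV) (\<lambda>p::real \<times> (real^'n). u t (snd p))"
    by (rule continuous_on_compose2) (auto intro!: continuous_intros)
  then have 2: "((\<lambda>p. dist (u t (snd p)) (u t x)) \<longlongrightarrow> 0) ?F"
    using t by (auto simp: continuous_on_def tendsto_dist_iff[symmetric])
  have "((\<lambda>p. dist (u (fst p) (snd p)) (u t x)) \<longlongrightarrow> 0) ?F"
  proof (rule tendsto_sandwich[OF _ _ tendsto_const])
    show "((\<lambda>p. dist (Bcontfun (u (fst p))) (Bcontfun (u t)) + dist (u t (snd p)) (u t x)) \<longlongrightarrow> 0) ?F"
      using tendsto_add[OF 1 2] by simp
    have "dist (u s y) (u t x) \<le> dist (Bcontfun (u s)) (Bcontfun (u t)) + dist (u t y) (u t x)" if "0 \<le> s" for s y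
      using dist_triangle[of "u s y" "u t x" "u t y"] dist_bounded[of "Bcontfun (u s)" y "Bcontfun (u t)"]
        C0_curves_Bcontfun[OF u that] C0_curves_Bcontfun[OF u, of t] t by simp
    then show "\<forall>\<^sub>F p in ?F. dist (u (fst p) (snd p)) (u t x)
        \<le> dist (Bcontfun (u (fst p))) (Bcontfun (u t)) + dist (u t (snd p)) (u t x)"
      by (auto simp: eventually_at_filter intro!: always_eventually)
  qed auto
  then show "((\<lambda>(t, x). u t x) \<longlongrightarrow> (case p0 of (t, x) \<Rightarrow> u t x)) (at p0 within {0..} \<times> UNIV)"
    by (simp add: tx case_prod_beta' tendsto_dist_iff[symmetric])
qed

lemma C0_curves_bounded:
  fixes u :: "real \<Rightarrow> real^'n \<Rightarrow> real"
  assumes u: "u \<in> C0_curves"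
  shows "\<exists>M. \<forall>t\<in>{0..T}. \<forall>x. \<bar>u t x\<bar> \<le> M"
proof -
  have "continuous_on {0..T} (\<lambda>t. Bcontfun (u t))"
    using u by (auto simp: C0_curves_def intro: continuous_on_subset)
  then have "bounded ((\<lambda>t. Bcontfun (u t)) ` {0..T})"
    by (intro compact_imp_bounded compact_continuous_image) auto
  then obtain M where "\<forall>t\<in>{0..T}. norm (Bcontfun (u t)) \<le> M" by (auto simp: bounded_iff)
  then show ?thesis
    using norm_bounded[of "Bcontfun (u t)" for t] C0_curves_Bcontfun[OF u]
    by (intro exI[of _ M] ballI allI) (metis atLeastAtMost_iff order_trans real_norm_def)
qed

lemma C0_curves_admissible:
  fixes u :: "real \<Rightarrow> real^'n \<Rightarrow> real"
  assumes "u \<in> C0_curves" and nonneg: "\<forall>t\<ge>0. \<forall>x. 0 \<le> u t x"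
  shows "admissible u"
  unfolding admissible_def
proof (intro conjI nonneg allI)
  have "(\<lambda>p. indicator ({0..} \<times> UNIV) p *\<^sub>R (case p of (t, x) \<Rightarrow> u t x)) \<in> borel_measurable borel"
    by (intro borel_measurable_continuous_on_indicator C0_curves_continuous assms)
       (auto intro!: borel_closed closed_Times)
  then show "(\<lambda>(t, x). indicator {0..} t * u t x) \<in> borel_measurable borel"
    by (rule measurable_cong[THEN iffD1, rotated]) (auto simp: indicator_def)
  show "\<exists>M. \<forall>t\<in>{0..T}. \<forall>x. u t x \<le> M" for T
    using C0_curves_bounded[OF assms(1), of T] by (meson abs_ge_self order_trans)
qed

lemma admissible_measurable:
  fixes u :: "real \<Rightarrow> real^'n \<Rightarrow> real"
  assumes "admissible u" "0 \<le> t"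
  shows "u t \<in> borel_measurable borel"
proof -
  have [measurable]: "(\<lambda>(t, x). indicator {0..} t * u t x) \<in> borel_measurable (borel \<Otimes>\<^sub>M borel)"
    using assms by (simp add: admissible_def borel_prod)
  have "(\<lambda>x. indicator {0..} t * u t x) \<in> borel_measurable borel" by measurable
  then show ?thesis using assms by simp
qed

lemma duhamel_term_eq:
  assumes "0 \<le> t"
  shows "duhamel_term \<gamma> q u t x =
    (LINT \<sigma>:{0<..<t}|lborel. heat_semigroup_weighted \<gamma> (t - \<sigma>) (\<lambda>y. u \<sigma> y powr q) x)"
  unfolding duhamel_term_def using assms by (simp add: zero_ereal_def interval_integral_Ioo)

lemma duhamel_term_nonneg:
  assumes "0 \<le> t" "\<And>t x. 0 \<le> t \<Longrightarrow> 0 \<le> u t x"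
  shows "0 \<le> duhamel_term \<gamma> q u t x"
  unfolding duhamel_term_eq[OF assms(1)] set_lebesgue_integral_def
  by (intro integral_nonneg_AE AE_I2) (auto intro!: mult_nonneg_nonneg heat_semigroup_weighted_nonneg)

lemma has_bochner_integral_powr_reflected:
  fixes a t :: real
  assumes "-1 < a" "0 \<le> t"
  shows "has_bochner_integral lborel (\<lambda>\<sigma>. indicator {0<..<t} \<sigma> * (t - \<sigma>) powr a) (t powr (a + 1) / (a + 1))"
proof -
  have "has_bochner_integral lborel (\<lambda>\<sigma>. indicator {0<..<t} (t + (-1) * \<sigma>) * (t + (-1) * \<sigma>) powr a)
     ((t powr (a + 1) / (a + 1)) /\<^sub>R \<bar>-1\<bar>)"
    using has_bochner_integral_powr_from_0[OF assms]
    by (subst lborel_has_bochner_integral_real_affine_iff[where c="-1" and t=t, symmetric]) auto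
  moreover have "indicator {0<..<t} (t + (-1) * \<sigma>) = (indicator {0<..<t} \<sigma> :: real)" for \<sigma>
    by (auto simp: indicator_def)
  ultimately show ?thesis by simp
qed

text \<open>The integrand is dominated by a constant times
  \<open>(t - \<sigma>) powr (- \<gamma> / 2)\<close>. Measurability is proved for the extension by
  0 to negative times, which agrees with \<open>u\<close> on the interval of integration.\<close>

lemma duhamel_integrand_integrable:
  fixes u :: "real \<Rightarrow> real^'n \<Rightarrow> real"
  assumes u: "admissible u" and \<gamma>: "0 \<le> \<gamma>" "\<gamma> < min 2 (real CARD('n))" and q: "0 < q" and t: "0 \<le> t"
  shows "set_integrable lborel {0<..<t} (\<lambda>\<sigma>. heat_semigroup_weighted \<gamma> (t - \<sigma>) (\<lambda>y. u \<sigma> y powr q) x)"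
proof -
  define v where "v = (\<lambda>t x. indicator {0..} t * u t x)"
  have [measurable]: "(\<lambda>(t, x). v t x) \<in> borel_measurable (borel \<Otimes>\<^sub>M borel)"
    using u by (simp add: admissible_def borel_prod v_def)
  obtain M where M: "\<forall>\<sigma>\<in>{0..t}. \<forall>x. u \<sigma> x \<le> M" using u unfolding admissible_def by blast
  obtain K where K: "0 < K" "\<forall>\<tau>>0. \<forall>\<phi> M. \<forall>x::real^'n. \<phi> \<in> borel_measurable borel \<longrightarrow> (\<forall>y. \<bar>\<phi> y\<bar> \<le> M) \<longrightarrow>
    \<bar>heat_semigroup_weighted \<gamma> \<tau> \<phi> x\<bar> \<le> K * M * \<tau> powr (- \<gamma> / 2)"
    using heat_semigroup_weighted_bound[where 'n='n, of \<gamma>] \<gamma> by auto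
  have eq: "indicator {0<..<t} \<sigma> *\<^sub>R heat_semigroup_weighted \<gamma> (t - \<sigma>) (\<lambda>y. u \<sigma> y powr q) x
      = indicator {0<..<t} \<sigma> *\<^sub>R heat_semigroup_weighted \<gamma> (t - \<sigma>) (\<lambda>y. v \<sigma> y powr q) x" for \<sigma>
    by (auto simp: indicator_def v_def)
  have meas: "(\<lambda>\<sigma>. heat_semigroup_weighted \<gamma> (t - \<sigma>) (\<lambda>y. v \<sigma> y powr q) x) \<in> borel_measurable borel"
    unfolding heat_semigroup_weighted_def by measurable
  show ?thesis unfolding set_integrable_def
  proof (rule Bochner_Integration.integrable_bound)
    have "integrable lborel (\<lambda>\<sigma>. indicator {0<..<t} \<sigma> * (t - \<sigma>) powr (- \<gamma> / 2))"
      using has_bochner_integral_powr_reflected[of "- \<gamma> / 2" t] \<gamma> t by (auto simp: has_bochner_integral_iff)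
    then show "integrable lborel (\<lambda>\<sigma>. K * M powr q * (indicator {0<..<t} \<sigma> * (t - \<sigma>) powr (- \<gamma> / 2)))"
      by (rule integrable_mult_right)
    show "(\<lambda>\<sigma>. indicator {0<..<t} \<sigma> *\<^sub>R heat_semigroup_weighted \<gamma> (t - \<sigma>) (\<lambda>y. u \<sigma> y powr q) x)
        \<in> borel_measurable lborel"
      unfolding eq using meas by measurable
    show "AE \<sigma> in lborel. norm (indicator {0<..<t} \<sigma> *\<^sub>R heat_semigroup_weighted \<gamma> (t - \<sigma>) (\<lambda>y. u \<sigma> y powr q) x)
        \<le> norm (K * M powr q * (indicator {0<..<t} \<sigma> * (t - \<sigma>) powr (- \<gamma> / 2)))"
    proof (rule AE_I2)
      fix \<sigma>
      show "norm (indicator {0<..<t} \<sigma> *\<^sub>R heat_semigroup_weighted \<gamma> (t - \<sigma>) (\<lambda>y. u \<sigma> y powr q) x)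
        \<le> norm (K * M powr q * (indicator {0<..<t} \<sigma> * (t - \<sigma>) powr (- \<gamma> / 2)))"
      proof (cases "\<sigma> \<in> {0<..<t}")
        case True
        then have [measurable]: "u \<sigma> \<in> borel_measurable borel" using admissible_measurable[OF u] by simp
        have "\<bar>u \<sigma> y powr q\<bar> \<le> M powr q" for y
          using True M u q by (auto simp: admissible_def intro!: powr_mono2)
        then have "\<bar>heat_semigroup_weighted \<gamma> (t - \<sigma>) (\<lambda>y. u \<sigma> y powr q) x\<bar> \<le> K * M powr q * (t - \<sigma>) powr (- \<gamma> / 2)"
          using True by (intro K(2)[rule_format]) auto
        then show ?thesis using True K by (simp add: abs_mult)
      qed simp
    qed
  qed
qed

section \<open>The lower barrier\<close>

text \<open>The Gaussian average defining \<open>eta0\<close>, restricted to rescaled displacements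
  in \<open>B\<close>. Its ratio to \<open>eta0\<close> is the factor lost when the Duhamel integral
  is cut down to \<open>B\<close>.\<close>

definition partial_eta :: "real \<Rightarrow> real \<Rightarrow> (real^'n) set \<Rightarrow> real" where
  "partial_eta q \<gamma> B = (4 * pi) powr (- real CARD('n) / 2) *
     (LINT z|lborel. indicator B z * (exp (- (norm z)\<^sup>2 / 4) * (1 + norm z) powr (- \<gamma> / (1 - q))))"

lemma partial_eta_UNIV: "partial_eta q \<gamma> (UNIV :: (real^'n) set) = eta0 TYPE('n) q \<gamma>"
  by (simp add: partial_eta_def eta0_def)

lemma integrable_partial_eta:
  assumes "0 \<le> \<gamma>" "q < 1" and [measurable]: "B \<in> sets borel"
  shows "integrable lborel (\<lambda>z::real^'n. indicator B z * (exp (- (norm z)\<^sup>2 / 4) * (1 + norm z) powr (- \<gamma> / (1 - q))))"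
proof (rule Bochner_Integration.integrable_bound[OF integrable_gauss])
  have "(1 + norm z) powr (- \<gamma> / (1 - q)) \<le> 1" for z :: "real^'n"
    using powr_mono2'[of "- \<gamma> / (1 - q)" 1 "1 + norm z"] assms by (simp add: divide_nonpos_pos)
  then show "AE z::real^'n in lborel. norm (indicator B z * (exp (- (norm z)\<^sup>2 / 4) * (1 + norm z) powr (- \<gamma> / (1 - q))))
      \<le> norm (exp (- (norm z)\<^sup>2 / 4))"
    by (intro AE_I2) (auto simp: indicator_def)
qed auto

lemma partial_eta_pos:
  fixes B :: "(real^'n) set"
  assumes "0 \<le> \<gamma>" "q < 1" "open U" "U \<noteq> {}" "U \<subseteq> B" and [measurable]: "B \<in> sets borel"
  shows "0 < partial_eta q \<gamma> B"
proof -
  let ?f = "\<lambda>z::real^'n. indicator B z * (exp (- (norm z)\<^sup>2 / 4) * (1 + norm z) powr (- \<gamma> / (1 - q)))"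
  have "(LINT z|lborel. ?f z) \<noteq> 0"
  proof
    assume "(LINT z|lborel. ?f z) = 0"
    then have "AE z in lborel. ?f z = 0"
      using integral_nonneg_eq_0_iff_AE[OF integrable_partial_eta[OF assms(1,2,6)]] by auto
    then have "AE z in lborel. z \<notin> U"
    proof eventually_elim
      case (elim z)
      moreover have "1 + norm z \<noteq> 0" by (smt (verit) norm_ge_zero)
      ultimately show ?case using assms(5) by (auto simp: indicator_def)
    qed
    then have "U \<in> null_sets lborel"
      using assms(3) by (subst AE_iff_null_sets) auto
    then have "U \<in> null_sets lebesgue"
      using null_sets_completionI by blast
    then show False
      using open_not_negligible[OF assms(3,4)] negligible_iff_null_sets by blast
  qed
  then show ?thesis
    unfolding partial_eta_def by (intro mult_pos_pos) (auto simp: less_le intro!: integral_nonneg_AE)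
qed

lemma eta0_pos:
  assumes "0 \<le> \<gamma>" "q < 1"
  shows "0 < eta0 TYPE('n::finite) q \<gamma>"
  using partial_eta_pos[OF assms, of UNIV "UNIV :: (real^'n) set"] by (simp add: partial_eta_UNIV)

text \<open>In the coordinates of the substitution \<open>y = x + sqrt \<tau> *\<^sub>R z\<close> one has
  \<open>norm y + sqrt \<sigma> \<le> (norm x + sqrt t) * (1 + norm z)\<close>, which separates the variables.\<close>

lemma heat_semigroup_weighted_lower_bound:
  fixes \<phi> :: "real^'n \<Rightarrow> real" and B :: "(real^'n) set"
  defines "a \<equiv> \<lambda>\<gamma> q :: real. \<gamma> / (1 - q)"
  assumes q: "0 < q" "q < 1" and \<gamma>: "0 < \<gamma>" "\<gamma> < real CARD('n)"
    and t: "0 < \<sigma>" "\<sigma> < t" and A: "0 \<le> A" and \<kappa>: "0 \<le> \<kappa>"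
    and [measurable]: "\<phi> \<in> borel_measurable borel" "B \<in> sets borel"
    and M: "\<And>y. \<bar>\<phi> y\<bar> \<le> M"
    and \<phi>: "\<And>y. A * (norm y + sqrt \<sigma>) powr (- q * a \<gamma> q) * exp (- \<kappa> * (norm y + sqrt \<sigma>)\<^sup>2) \<le> \<phi> y"
    and B: "\<And>z. z \<in> B \<Longrightarrow> \<kappa> * (1 + norm z)\<^sup>2 \<le> \<kappa> * m"
  shows "A * (norm x + sqrt t) powr (- a \<gamma> q) * exp (- \<kappa> * m * (norm x + sqrt t)\<^sup>2) * partial_eta q \<gamma> B
    \<le> heat_semigroup_weighted \<gamma> (t - \<sigma>) \<phi> x"
proof -
  define X where "X = norm x + sqrt t"
  define \<tau> where "\<tau> = t - \<sigma>"
  let ?e = "\<lambda>z::real^'n. exp (- (norm z)\<^sup>2 / 4)"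
  let ?c = "A * X powr (- a \<gamma> q) * exp (- \<kappa> * m * X\<^sup>2)"
  have X: "0 < X" using t by (simp add: X_def add_nonneg_pos)
  have \<tau>: "0 < \<tau>" using t by (simp add: \<tau>_def)
  \<comment> \<open>The identity that selects the exponent of the barrier: the weight contributes
    \<open>\<gamma>\<close>, the power \<open>q\<close> of the barrier contributes
    \<open>q * a\<close>, and together they give \<open>a\<close> back.\<close>
  have a: "0 < a \<gamma> q" "\<gamma> + q * a \<gamma> q = a \<gamma> q" using q \<gamma> by (auto simp: a_def field_simps)
  have main: "?c * (indicator B z * (?e z * (1 + norm z) powr (- a \<gamma> q)))
      \<le> ?e z * norm (x + sqrt \<tau> *\<^sub>R z) powr (- \<gamma>) * \<phi> (x + sqrt \<tau> *\<^sub>R z)"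
    if nz: "x + sqrt \<tau> *\<^sub>R z \<noteq> 0" for z
  proof -
    define y where "y = x + sqrt \<tau> *\<^sub>R z"
    define r where "r = norm y + sqrt \<sigma>"
    have y: "0 < norm y" using nz by (simp add: y_def)
    have r: "0 < r" "norm y \<le> r" using t y by (auto simp: r_def intro!: add_pos_pos)
    have "norm y \<le> norm x + sqrt \<tau> * norm z"
      using norm_triangle_ineq[of x "sqrt \<tau> *\<^sub>R z"] \<tau> by (simp add: y_def)
    also have "\<dots> \<le> norm x + sqrt t * norm z" using t by (simp add: \<tau>_def mult_right_mono)
    finally have "r \<le> norm x + sqrt t * norm z + sqrt t" using t by (simp add: r_def add_mono)
    also have "\<dots> \<le> X * (1 + norm z)" by (simp add: X_def algebra_simps)
    finally have rX: "r \<le> X * (1 + norm z)" .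
    have lower: "A * r powr (- q * a \<gamma> q) * exp (- \<kappa> * r\<^sup>2) \<le> \<phi> y" using \<phi>[of y] by (simp add: r_def)
    then have \<phi>0: "0 \<le> \<phi> y" using A by (meson exp_ge_zero mult_nonneg_nonneg order_trans powr_ge_zero)
    show ?thesis
    proof (cases "z \<in> B")
      case False
      then show ?thesis using \<phi>0 by (simp add: y_def)
    next
      case True
      have "?c * (1 + norm z) powr (- a \<gamma> q) = A * (X * (1 + norm z)) powr (- a \<gamma> q) * exp (- \<kappa> * m * X\<^sup>2)"
        using X by (simp add: powr_mult)
      also have "\<dots> \<le> A * r powr (- a \<gamma> q) * exp (- \<kappa> * r\<^sup>2)"
      proof (intro mult_mono mult_left_mono A)
        show "(X * (1 + norm z)) powr (- a \<gamma> q) \<le> r powr (- a \<gamma> q)"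
          using a r rX by (intro powr_mono2') auto
        have "\<kappa> * r\<^sup>2 \<le> \<kappa> * (X * (1 + norm z))\<^sup>2"
          using \<kappa> r rX by (intro mult_left_mono power_mono) auto
        also have "\<dots> = (\<kappa> * (1 + norm z)\<^sup>2) * X\<^sup>2" by (simp add: power_mult_distrib)
        also have "\<dots> \<le> \<kappa> * m * X\<^sup>2" using B[OF True] by (intro mult_right_mono) auto
        finally show "exp (- \<kappa> * m * X\<^sup>2) \<le> exp (- \<kappa> * r\<^sup>2)" by simp
      qed (use A in auto)
      also have "\<dots> = r powr (- \<gamma>) * (A * r powr (- q * a \<gamma> q) * exp (- \<kappa> * r\<^sup>2))"
      proof -
        have "- a \<gamma> q = - \<gamma> + - q * a \<gamma> q" using a(2) by simp
        then have "r powr (- a \<gamma> q) = r powr (- \<gamma>) * r powr (- q * a \<gamma> q)"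
          by (metis powr_add)
        then show ?thesis by simp
      qed
      also have "\<dots> \<le> norm y powr (- \<gamma>) * \<phi> y"
      proof (intro mult_mono lower)
        show "r powr (- \<gamma>) \<le> norm y powr (- \<gamma>)" using y r \<gamma> by (intro powr_mono2') auto
      qed (use A in auto)
      finally have "?e z * (?c * (1 + norm z) powr (- a \<gamma> q)) \<le> ?e z * (norm y powr (- \<gamma>) * \<phi> y)"
        by (intro mult_left_mono) auto
      then show ?thesis using True by (simp add: y_def mult_ac)
    qed
  qed
  have "(LINT z|lborel. ?c * (indicator B z * (?e z * (1 + norm z) powr (- a \<gamma> q))))
      \<le> (LINT z|lborel. ?e z * norm (x + sqrt \<tau> *\<^sub>R z) powr (- \<gamma>) * \<phi> (x + sqrt \<tau> *\<^sub>R z))"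
  proof (rule integral_mono_AE)
    show "integrable lborel (\<lambda>z. ?c * (indicator B z * (?e z * (1 + norm z) powr (- a \<gamma> q))))"
      using integrable_partial_eta[of \<gamma> q B] \<gamma> q by (intro integrable_mult_right) (auto simp: a_def)
    show "integrable lborel (\<lambda>z. ?e z * norm (x + sqrt \<tau> *\<^sub>R z) powr (- \<gamma>) * \<phi> (x + sqrt \<tau> *\<^sub>R z))"
      using \<gamma> \<tau> M by (intro integrable_heat_semigroup_weighted) auto
    \<comment> \<open>The single point with \<open>x + sqrt \<tau> *\<^sub>R z = 0\<close> must be
      left out, since there the singular weight evaluates to 0 instead of being large.\<close>
    show "AE z in lborel. ?c * (indicator B z * (?e z * (1 + norm z) powr (- a \<gamma> q)))
        \<le> ?e z * norm (x + sqrt \<tau> *\<^sub>R z) powr (- \<gamma>) * \<phi> (x + sqrt \<tau> *\<^sub>R z)"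
      using AE_lborel_singleton[of "- x /\<^sub>R sqrt \<tau>"]
    proof eventually_elim
      case (elim z)
      have "x + sqrt \<tau> *\<^sub>R z \<noteq> 0"
      proof
        assume "x + sqrt \<tau> *\<^sub>R z = 0"
        then have "sqrt \<tau> *\<^sub>R z = - x" by (simp add: eq_neg_iff_add_eq_0 add.commute)
        then have "z = - x /\<^sub>R sqrt \<tau>" using \<tau> by (metis inverse_eq_divide scaleR_one scaleR_scaleR
              left_inverse order_less_irrefl real_sqrt_eq_zero_cancel_iff)
        with elim show False by simp
      qed
      then show ?case by (rule main)
    qed
  qed
  then have "(4 * pi) powr (- real CARD('n) / 2) *
      (?c * (LINT z|lborel. indicator B z * (?e z * (1 + norm z) powr (- a \<gamma> q))))
      \<le> heat_semigroup_weighted \<gamma> \<tau> \<phi> x"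
    using \<tau> by (simp add: heat_semigroup_weighted_eq mult_left_mono)
  then show ?thesis
    by (simp add: partial_eta_def X_def \<tau>_def a_def mult_ac)
qed

section \<open>Size and time continuity of the barrier\<close>

lemma lower_barrier_pos:
  assumes "0 \<le> \<gamma>" "q < 1" "0 < t"
  shows "0 < lower_barrier q \<gamma> t (x::real^'n)"
proof -
  have "norm x + sqrt t \<noteq> 0" using assms by (smt (verit) norm_ge_zero real_sqrt_gt_zero)
  then show ?thesis
    using assms eta0_pos[OF assms(1,2), where 'n='n] by (simp add: lower_barrier_def)
qed

lemma lower_barrier_nonneg: "0 \<le> lower_barrier q \<gamma> t x"
  by (simp add: lower_barrier_def)

lemma lower_barrier_zero [simp]: "lower_barrier q \<gamma> 0 x = 0"
  by (simp add: lower_barrier_def)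

text \<open>Dropping \<open>norm x\<close> from the base enlarges the negative power. The exponent
  that remains is the growth rate \<open>m\<close> that also governs the difference of two
  solutions.\<close>

lemma lower_barrier_bound:
  assumes q: "q < 1" and \<gamma>: "0 \<le> \<gamma>" and t: "0 < t"
  shows "lower_barrier q \<gamma> t (x::real^'n)
    \<le> ((1 - q) * eta0 TYPE('n) q \<gamma>) powr (1 / (1 - q)) * t powr ((1 - \<gamma> / 2) / (1 - q))"
proof -
  have "(norm x + sqrt t) powr (- \<gamma> / (1 - q)) \<le> sqrt t powr (- \<gamma> / (1 - q))"
    using assms by (intro powr_mono2') (auto simp: divide_nonpos_pos)
  also have "\<dots> = t powr (- \<gamma> / 2 / (1 - q))"
    using t by (simp add: powr_half_sqrt[symmetric] powr_powr)
  finally have "lower_barrier q \<gamma> t x \<le> ((1 - q) * eta0 TYPE('n) q \<gamma>) powr (1 / (1 - q)) * t powr (1 / (1 - q))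
      * t powr (- \<gamma> / 2 / (1 - q))"
    unfolding lower_barrier_def by (intro mult_left_mono) auto
  moreover have "t powr (1 / (1 - q)) * t powr (- \<gamma> / 2 / (1 - q)) = t powr ((1 - \<gamma> / 2) / (1 - q))"
  proof -
    have "1 / (1 - q) + - \<gamma> / 2 / (1 - q) = (1 - \<gamma> / 2) / (1 - q)"
      by (subst add_divide_distrib[symmetric]) simp
    then show ?thesis by (metis powr_add)
  qed
  ultimately show ?thesis by (simp only: mult.assoc)
qed

lemma lower_barrier_C0:
  assumes q: "q < 1" and \<gamma>: "0 < \<gamma>" and t: "0 \<le> t"
  shows "lower_barrier q \<gamma> t \<in> (C0 :: (real^'n \<Rightarrow> real) set)"
proof (rule vanishing_at_infinity_C0)
  show "continuous_on UNIV (lower_barrier q \<gamma> t :: real^'n \<Rightarrow> real)"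
  proof (cases "t = 0")
    case True
    then show ?thesis by (simp add: lower_barrier_def)
  next
    case False
    then have "norm x + sqrt t \<noteq> 0" for x :: "real^'n"
      using t by (smt (verit) norm_ge_zero real_sqrt_gt_zero)
    then show ?thesis unfolding lower_barrier_def by (intro continuous_intros) auto
  qed
  have "filterlim (\<lambda>x::real^'n. norm x + sqrt t) at_top at_infinity"
    using filterlim_tendsto_add_at_top[OF tendsto_const[of "sqrt t"] filterlim_norm_at_top]
    by (simp add: add.commute)
  then have "((\<lambda>x::real^'n. (norm x + sqrt t) powr (- \<gamma> / (1 - q))) \<longlongrightarrow> 0) at_infinity"
    using q \<gamma> by (intro tendsto_neg_powr) (auto simp: divide_neg_pos)
  then show "((lower_barrier q \<gamma> t :: real^'n \<Rightarrow> real) \<longlongrightarrow> 0) at_infinity"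
    unfolding lower_barrier_def by (rule tendsto_mult_right_zero)
qed

text \<open>For s <= t, write the difference as \<open>s powr (- a) * (1 - (s / t) powr a)\<close>;
  adding \<open>r\<close> to both points decreases each factor. This removes \<open>norm x\<close>
  from the time increments of the barrier and makes its continuity uniform in space.\<close>

lemma powr_shift_diff:
  fixes s t r a :: real
  assumes "0 < s" "0 < t" "0 \<le> r" "0 \<le> a"
  shows "\<bar>(r + s) powr (- a) - (r + t) powr (- a)\<bar> \<le> \<bar>s powr (- a) - t powr (- a)\<bar>"
proof -
  have main: "(r + s) powr (- a) - (r + t) powr (- a) \<le> s powr (- a) - t powr (- a)"
      "0 \<le> (r + s) powr (- a) - (r + t) powr (- a)"
    if st: "0 < s" "s \<le> t" for s t :: real
  proof -
    have "(s / t) powr a \<le> ((r + s) / (r + t)) powr a"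
      using st assms by (intro powr_mono2) (auto simp: field_simps intro: mult_left_mono)
    moreover have "((r + s) / (r + t)) powr a \<le> 1"
      using st assms by (intro powr_le1) auto
    ultimately have 1: "0 \<le> 1 - ((r + s) / (r + t)) powr a" "1 - ((r + s) / (r + t)) powr a \<le> 1 - (s / t) powr a"
      by auto
    have eq: "u powr (- a) - v powr (- a) = u powr (- a) * (1 - (u / v) powr a)" if "0 < u" "0 < v" for u v
      using that by (simp add: powr_minus powr_divide field_simps)
    have "(r + s) powr (- a) \<le> s powr (- a)"
      using st assms by (intro powr_mono2') auto
    then have "(r + s) powr (- a) * (1 - ((r + s) / (r + t)) powr a) \<le> s powr (- a) * (1 - (s / t) powr a)"
      using 1 by (intro mult_mono) auto
    then show "(r + s) powr (- a) - (r + t) powr (- a) \<le> s powr (- a) - t powr (- a)"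
      using st assms eq[of s t] eq[of "r + s" "r + t"] by simp
    show "0 \<le> (r + s) powr (- a) - (r + t) powr (- a)"
      using st assms eq[of "r + s" "r + t"] 1 by simp
  qed
  show ?thesis
  proof (cases "s \<le> t")
    case True
    then show ?thesis using main[of s t] assms by simp
  next
    case False
    then show ?thesis using main[of t s] assms by simp
  qed
qed

lemma lower_barrier_C0_curves:
  assumes q: "q < 1" and \<gamma>: "0 < \<gamma>" "\<gamma> < 2"
  shows "(lower_barrier q \<gamma> :: real \<Rightarrow> real^'n \<Rightarrow> real) \<in> C0_curves"
proof -
  let ?w = "lower_barrier q \<gamma> :: real \<Rightarrow> real^'n \<Rightarrow> real"
  define C where "C = ((1 - q) * eta0 TYPE('n) q \<gamma>) powr (1 / (1 - q))"
  define a where "a = \<gamma> / (1 - q)"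
  define b where "b = 1 / (1 - q)"
  have a: "0 < a" and C: "0 \<le> C" and b: "0 < b" using q \<gamma> by (auto simp: a_def C_def b_def)
  have w: "?w t x = C * t powr b * (norm x + sqrt t) powr (- a)" for t x
    by (simp add: lower_barrier_def C_def a_def b_def)
  have Bw: "apply_bcontfun (Bcontfun (?w t)) = ?w t" if "0 \<le> t" for t
    using lower_barrier_C0[OF q \<gamma>(1) that, where 'n='n] by (auto simp: C0_def apply_bcontfun_inverse)
  have "continuous_on {0..} (\<lambda>t. Bcontfun (?w t))"
    unfolding continuous_on_def
  proof (rule ballI, rule iffD2[OF tendsto_dist_iff])
    fix t :: real assume t: "t \<in> {0..}"
    let ?F = "at t within {0..}"
    \<comment> \<open>A modulus of continuity independent of \<open>x\<close>. Time 0 is separate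
      because \<open>sqrt t powr (- a)\<close> is not continuous there; the bound by a positive
      power of \<open>s\<close> (here \<open>\<gamma> < 2\<close>) replaces it.\<close>
    have "\<exists>d. (d \<longlongrightarrow> 0) ?F \<and> (\<forall>\<^sub>F s in ?F. \<forall>x. \<bar>?w s x - ?w t x\<bar> \<le> d s)"
    proof (cases "t = 0")
      case True
      let ?d = "\<lambda>s. C * s powr ((1 - \<gamma> / 2) / (1 - q))"
      have "(?d \<longlongrightarrow> C * 0 powr ((1 - \<gamma> / 2) / (1 - q))) ?F"
        unfolding True using q \<gamma> by (intro tendsto_intros) (auto simp: eventually_at_filter)
      moreover have "\<bar>?w s x - ?w t x\<bar> \<le> ?d s" if "0 < s" for s x
        using lower_barrier_bound[OF q _ that, of \<gamma> x] \<gamma> lower_barrier_nonneg[of q \<gamma> s x]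
        by (simp add: True C_def)
      then have "\<forall>\<^sub>F s in ?F. \<forall>x. \<bar>?w s x - ?w t x\<bar> \<le> ?d s"
        by (auto simp: True eventually_at_filter intro!: always_eventually)
      ultimately show ?thesis by (intro exI[of _ ?d]) simp
    next
      case False
      then have t: "0 < t" using t by simp
      let ?d = "\<lambda>s. C * (\<bar>s powr b - t powr b\<bar> * sqrt s powr (- a) + t powr b * \<bar>sqrt s powr (- a) - sqrt t powr (- a)\<bar>)"
      have "(?d \<longlongrightarrow> C * (\<bar>t powr b - t powr b\<bar> * sqrt t powr (- a) + t powr b * \<bar>sqrt t powr (- a) - sqrt t powr (- a)\<bar>)) ?F"
        using t by (intro tendsto_intros) auto
      moreover have "\<bar>?w s x - ?w t x\<bar> \<le> ?d s" if s: "0 < s" for s x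
      proof -
        let ?g = "\<lambda>s. (norm x + sqrt s) powr (- a)"
        have "?w s x - ?w t x = C * ((s powr b - t powr b) * ?g s + t powr b * (?g s - ?g t))"
          by (simp add: w algebra_simps)
        then have "\<bar>?w s x - ?w t x\<bar> \<le> C * (\<bar>s powr b - t powr b\<bar> * ?g s + t powr b * \<bar>?g s - ?g t\<bar>)"
          using C abs_triangle_ineq[of "(s powr b - t powr b) * ?g s" "t powr b * (?g s - ?g t)"]
          by (simp add: abs_mult mult_left_mono)
        also have "\<dots> \<le> ?d s"
          using s t a C by (intro mult_left_mono add_mono powr_shift_diff powr_mono2') auto
        finally show ?thesis .
      qed
      moreover have "\<forall>\<^sub>F s in ?F. 0 < s"
        using t by (auto simp: eventually_at dist_real_def intro!: exI[of _ t])
      ultimately show ?thesis by (intro exI[of _ ?d]) (auto elim: eventually_mono)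
    qed
    then obtain d where d: "(d \<longlongrightarrow> 0) ?F" "\<forall>\<^sub>F s in ?F. \<forall>x. \<bar>?w s x - ?w t x\<bar> \<le> d s" by blast
    have "\<forall>\<^sub>F s in ?F. 0 \<le> s" by (auto simp: eventually_at_filter)
    with d(2) have "\<forall>\<^sub>F s in ?F. dist (Bcontfun (?w s)) (Bcontfun (?w t)) \<le> d s"
    proof eventually_elim
      case (elim s)
      then show ?case using t by (intro dist_bound) (simp add: Bw dist_real_def)
    qed
    then show "((\<lambda>s. dist (Bcontfun (?w s)) (Bcontfun (?w t))) \<longlongrightarrow> 0) ?F"
      by (intro tendsto_sandwich[OF _ _ tendsto_const d(1)]) auto
  qed
  then show ?thesis using lower_barrier_C0[OF q \<gamma>(1), where 'n='n] by (simp add: C0_curves_def)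
qed

text \<open>One Duhamel step applied to a Gaussian multiple of the barrier: the power
  \<open>q\<close> acts on \<open>\<theta>\<close> and on the exponent \<open>\<kappa>\<close>, and
  restricting to \<open>B\<close> costs the ratio of \<open>partial_eta\<close> to
  \<open>eta0\<close>. Only times after \<open>\<epsilon>\<close> are kept, the integrand being
  non-negative before. The condition on \<open>B\<close> carries the factor \<open>\<kappa>\<close>
  so that \<open>\<kappa> = 0\<close> admits the whole space.\<close>

lemma duhamel_term_barrier_step:
  fixes u :: "real \<Rightarrow> real^'n \<Rightarrow> real" and B :: "(real^'n) set"
  assumes q: "0 < q" "q < 1" and \<gamma>: "0 < \<gamma>" "\<gamma> < min 2 (real CARD('n))"
    and u: "admissible u" and \<epsilon>: "0 \<le> \<epsilon>" and t: "0 < t" and \<theta>: "0 \<le> \<theta>" and \<kappa>: "0 \<le> \<kappa>"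
    and [measurable]: "B \<in> sets borel"
    and B: "\<And>z. z \<in> B \<Longrightarrow> \<kappa> * (1 + norm z)\<^sup>2 \<le> \<kappa> * m"
    and lower: "\<And>\<sigma> y. 0 < \<sigma> \<Longrightarrow> \<sigma> < t \<Longrightarrow>
      \<theta> * exp (- \<kappa> * (norm y + sqrt \<sigma>)\<^sup>2) * lower_barrier q \<gamma> \<sigma> y \<le> u (\<sigma> + \<epsilon>) y"
  shows "\<theta> powr q * (partial_eta q \<gamma> B / eta0 TYPE('n) q \<gamma>) * exp (- (q * \<kappa> * m) * (norm x + sqrt t)\<^sup>2)
      * lower_barrier q \<gamma> t x \<le> duhamel_term \<gamma> q u (t + \<epsilon>) x"
proof -
  define c0 where "c0 = (1 - q) * eta0 TYPE('n) q \<gamma>"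
  define C where "C = c0 powr (1 / (1 - q))"
  define p where "p = q / (1 - q)"
  define X where "X = norm x + sqrt t"
  define G where "G = \<theta> powr q * C powr q * (X powr (- (\<gamma> / (1 - q))) * exp (- (q * \<kappa>) * m * X\<^sup>2)) * partial_eta q \<gamma> B"
  define F where "F = (\<lambda>\<sigma>. heat_semigroup_weighted \<gamma> (t + \<epsilon> - \<sigma>) (\<lambda>y. u \<sigma> y powr q) x)"
  have eta: "0 < eta0 TYPE('n) q \<gamma>" using eta0_pos[of \<gamma> q, where 'n='n] q \<gamma> by auto
  have c0: "0 < c0" using q eta by (simp add: c0_def)
  \<comment> \<open>\<open>p\<close> is the time exponent of the barrier raised to \<open>q\<close>;
    integrating in time restores the exponent \<open>1 / (1 - q)\<close> and produces the factor
    \<open>1 - q\<close>.\<close>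
  have p: "0 < p" "p + 1 = 1 / (1 - q)" using q by (auto simp: p_def field_simps)
  have u0: "0 \<le> u \<sigma> y" if "0 \<le> \<sigma>" for \<sigma> y using u that by (auto simp: admissible_def)
  have F: "G * s powr p \<le> F (s + \<epsilon>)" if s: "0 < s" "s < t" for s
  proof -
    let ?A = "\<theta> powr q * C powr q * s powr p"
    have s\<epsilon>: "0 \<le> s + \<epsilon>" using s \<epsilon> by simp
    have [measurable]: "u (s + \<epsilon>) \<in> borel_measurable borel" using admissible_measurable[OF u s\<epsilon>] .
    obtain M where M: "\<forall>x. u (s + \<epsilon>) x \<le> M"
      using u s\<epsilon> unfolding admissible_def by (meson atLeastAtMost_iff order_refl)
    have "?A * (norm y + sqrt s) powr (- q * (\<gamma> / (1 - q))) * exp (- (q * \<kappa>) * (norm y + sqrt s)\<^sup>2) \<le> u (s + \<epsilon>) y powr q" for y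
    proof -
      have "(\<theta> * exp (- \<kappa> * (norm y + sqrt s)\<^sup>2) * lower_barrier q \<gamma> s y) powr q \<le> u (s + \<epsilon>) y powr q"
        using lower[OF s] q \<theta> lower_barrier_nonneg[of q \<gamma> s y] by (intro powr_mono2) auto
      moreover have "lower_barrier q \<gamma> s y powr q = C powr q * s powr p * (norm y + sqrt s) powr (- q * (\<gamma> / (1 - q)))"
        using s by (simp add: lower_barrier_def powr_mult powr_powr p_def C_def c0_def mult.commute)
      ultimately show ?thesis
        using \<theta> lower_barrier_nonneg[of q \<gamma> s y] by (simp add: powr_mult exp_powr_real mult_ac)
    qed
    moreover have "\<bar>u (s + \<epsilon>) y powr q\<bar> \<le> M powr q" for y
      using M u0[OF s\<epsilon>] q by (auto intro!: powr_mono2)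
    moreover have "q * \<kappa> * (1 + norm z)\<^sup>2 \<le> q * \<kappa> * m" if "z \<in> B" for z
      using B[OF that] q by (simp add: mult.assoc)
    ultimately have "?A * X powr (- (\<gamma> / (1 - q))) * exp (- (q * \<kappa>) * m * X\<^sup>2) * partial_eta q \<gamma> B
      \<le> heat_semigroup_weighted \<gamma> (t - s) (\<lambda>y. u (s + \<epsilon>) y powr q) x"
      unfolding X_def using s \<gamma> q \<kappa> \<theta>
      by (intro heat_semigroup_weighted_lower_bound[where M="M powr q" and \<sigma>=s]) auto
    then show ?thesis by (simp add: G_def F_def mult_ac)
  qed
  have "has_bochner_integral lborel (\<lambda>\<sigma>. indicator {0<..<t} (- \<epsilon> + 1 * \<sigma>) * (- \<epsilon> + 1 * \<sigma>) powr p)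
     ((t powr (p + 1) / (p + 1)) /\<^sub>R \<bar>1\<bar>)"
    using has_bochner_integral_powr_from_0[of p t] p t
    by (subst lborel_has_bochner_integral_real_affine_iff[where c=1 and t="- \<epsilon>", symmetric]) auto
  then have "has_bochner_integral lborel (\<lambda>\<sigma>. G * (indicator {0<..<t} (- \<epsilon> + 1 * \<sigma>) * (- \<epsilon> + 1 * \<sigma>) powr p))
     (G * ((t powr (p + 1) / (p + 1)) /\<^sub>R \<bar>1\<bar>))"
    by (rule has_bochner_integral_mult_right)
  then have hb: "integrable lborel (\<lambda>\<sigma>. G * (indicator {0<..<t} (- \<epsilon> + 1 * \<sigma>) * (- \<epsilon> + 1 * \<sigma>) powr p))"
    "(LINT \<sigma>|lborel. G * (indicator {0<..<t} (- \<epsilon> + 1 * \<sigma>) * (- \<epsilon> + 1 * \<sigma>) powr p))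
      = G * ((1 - q) * t powr (1 / (1 - q)))"
    by (auto simp: has_bochner_integral_iff p(2))
  have "G * ((1 - q) * t powr (1 / (1 - q))) \<le> (LINT \<sigma>:{0<..<t + \<epsilon>}|lborel. F \<sigma>)"
    unfolding hb(2)[symmetric] set_lebesgue_integral_def
  proof (rule integral_mono[OF hb(1)])
    show "integrable lborel (\<lambda>\<sigma>. indicator {0<..<t + \<epsilon>} \<sigma> *\<^sub>R F \<sigma>)"
      using duhamel_integrand_integrable[OF u _ \<gamma>(2) q(1), of "t + \<epsilon>" x] \<gamma> t \<epsilon>
      by (simp add: set_integrable_def F_def)
    show "G * (indicator {0<..<t} (- \<epsilon> + 1 * \<sigma>) * (- \<epsilon> + 1 * \<sigma>) powr p) \<le> indicator {0<..<t + \<epsilon>} \<sigma> *\<^sub>R F \<sigma>" for \<sigma>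
    proof (cases "\<sigma> - \<epsilon> \<in> {0<..<t}")
      case True
      then show ?thesis using F[of "\<sigma> - \<epsilon>"] \<epsilon> by (simp add: indicator_def)
    next
      case False
      moreover have "0 \<le> F \<sigma>" by (simp add: F_def heat_semigroup_weighted_nonneg)
      ultimately show ?thesis by (auto simp: indicator_def)
    qed
  qed
  also have "\<dots> = duhamel_term \<gamma> q u (t + \<epsilon>) x"
    using t \<epsilon> by (simp add: duhamel_term_eq F_def)
  finally have "G * ((1 - q) * t powr (1 / (1 - q))) \<le> duhamel_term \<gamma> q u (t + \<epsilon>) x" .
  \<comment> \<open>This fixed-point equation determines the constant in front of the
    barrier.\<close>
  moreover have C: "C powr q * (1 - q) = C / eta0 TYPE('n) q \<gamma>"
  proof -
    have "C = c0 powr p * c0 powr 1" unfolding C_def p(2)[symmetric] by (rule powr_add)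
    moreover have "C powr q = c0 powr p" by (simp add: C_def powr_powr p_def)
    ultimately have "C = C powr q * c0" using c0 by simp
    then show ?thesis using eta by (simp add: c0_def field_simps)
  qed
  have "G * ((1 - q) * t powr (1 / (1 - q))) = \<theta> powr q * (C powr q * (1 - q))
      * (X powr (- (\<gamma> / (1 - q))) * exp (- (q * \<kappa>) * m * X\<^sup>2)) * partial_eta q \<gamma> B * t powr (1 / (1 - q))"
    unfolding G_def by (simp only: mult_ac)
  ultimately show ?thesis
    unfolding C by (simp add: lower_barrier_def X_def C_def c0_def mult_ac)
qed

lemma lower_barrier_subsolution:
  assumes q: "0 < q" "q < 1" and \<gamma>: "0 < \<gamma>" "\<gamma> < min 2 (real CARD('n::finite))" and t: "0 \<le> t"
  shows "lower_barrier q \<gamma> t (x::real^'n) \<le> duhamel_term \<gamma> q (lower_barrier q \<gamma>) t x"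
proof (cases "t = 0")
  case True
  then show ?thesis using duhamel_term_nonneg[of 0 "lower_barrier q \<gamma> :: real \<Rightarrow> real^'n \<Rightarrow> real"] by (simp add: lower_barrier_nonneg)
next
  case False
  have "admissible (lower_barrier q \<gamma> :: real \<Rightarrow> real^'n \<Rightarrow> real)"
    using q \<gamma> by (intro C0_curves_admissible lower_barrier_C0_curves) (auto simp: lower_barrier_nonneg)
  from duhamel_term_barrier_step[OF q \<gamma> this, where \<epsilon>=0 and \<theta>=1 and \<kappa>=0 and B=UNIV and t=t and x=x]
  show ?thesis using False t eta0_pos[of \<gamma> q, where 'n='n] q \<gamma> by (simp add: partial_eta_UNIV)
qed

section \<open>Positivity and the lower bound\<close>

lemma lborel_integrable_affine:
  fixes f :: "'a::euclidean_space \<Rightarrow> real"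
  assumes [measurable]: "f \<in> borel_measurable borel" and c: "c \<noteq> 0"
    and int: "integrable lborel (\<lambda>z. f (x + c *\<^sub>R z))"
  shows "integrable lborel f"
proof -
  have "integrable (distr lborel borel (\<lambda>z. x + c *\<^sub>R z)) f"
    by (subst integrable_distr_eq) (use int in auto)
  then have "integrable (density (distr lborel borel (\<lambda>z. x + c *\<^sub>R z)) (\<lambda>_. ennreal (\<bar>c\<bar> ^ DIM('a)))) f"
    by (subst integrable_density) auto
  then show ?thesis unfolding lborel_affine[OF c, of x, symmetric] .
qed

text \<open>Only the mass in the ball is kept; every point of it lies within
  \<open>norm x + norm x0 + r\<close> of \<open>x\<close>.\<close>

lemma heat_semigroup_lower_bound:
  fixes \<phi> :: "real^'n \<Rightarrow> real"
  assumes [measurable]: "\<phi> \<in> borel_measurable borel" and \<phi>: "\<And>y. 0 \<le> \<phi> y" "\<And>y. \<phi> y \<le> M"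
    and c: "\<And>y. y \<in> ball x0 r \<Longrightarrow> c \<le> \<phi> y" "0 \<le> c" and s: "0 < s"
  shows "(4 * pi * s) powr (- real CARD('n) / 2) *
      (c * exp (- (norm x + (norm x0 + r))\<^sup>2 / (4 * s)) * measure lborel (ball x0 r)) \<le> heat_semigroup s \<phi> x"
proof -
  let ?D = "norm x0 + r"
  have "(LINT y|lborel. indicator (ball x0 r) y * (c * exp (- (norm x + ?D)\<^sup>2 / (4 * s))))
      \<le> (LINT y|lborel. exp (- (norm (x - y))\<^sup>2 / (4 * s)) * \<phi> y)"
  proof (rule integral_mono)
    show "integrable lborel (\<lambda>y. indicator (ball x0 r) y * (c * exp (- (norm x + ?D)\<^sup>2 / (4 * s))))"
      using emeasure_lborel_ball_finite[of x0 r] by (intro integrable_mult_left integrable_real_indicator) auto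
    have "integrable lborel (\<lambda>y. exp (- (norm (x - y))\<^sup>2 / (4 * s)))"
    proof (rule lborel_integrable_affine[where x=x and c="sqrt s"])
      have "(\<lambda>z. exp (- (norm (x - (x + sqrt s *\<^sub>R z)))\<^sup>2 / (4 * s))) = (\<lambda>z. exp (- (norm z)\<^sup>2 / 4))"
        using s by (auto simp: power_mult_distrib)
      then show "integrable lborel (\<lambda>z. exp (- (norm (x - (x + sqrt s *\<^sub>R z)))\<^sup>2 / (4 * s)))"
        by (simp only: integrable_gauss)
    qed (use s in auto)
    then have "integrable lborel (\<lambda>y. exp (- (norm (x - y))\<^sup>2 / (4 * s)) * M)"
      by (rule integrable_mult_left)
    then show "integrable lborel (\<lambda>y. exp (- (norm (x - y))\<^sup>2 / (4 * s)) * \<phi> y)"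
      by (rule Bochner_Integration.integrable_bound) (use \<phi> order_trans[OF \<phi>] in \<open>auto intro!: AE_I2 simp: abs_mult mult_left_mono\<close>)
    fix y :: "real^'n"
    show "indicator (ball x0 r) y * (c * exp (- (norm x + ?D)\<^sup>2 / (4 * s))) \<le> exp (- (norm (x - y))\<^sup>2 / (4 * s)) * \<phi> y"
    proof (cases "y \<in> ball x0 r")
      case True
      have "norm y \<le> norm x0 + dist x0 y" by (metis add.commute dist_commute dist_norm norm_triangle_sub)
      then have "norm y \<le> ?D" using True by simp
      then have "norm (x - y) \<le> norm x + ?D" using norm_triangle_ineq4[of x y] by linarith
      then have "(norm (x - y))\<^sup>2 \<le> (norm x + ?D)\<^sup>2" by (intro power_mono) auto
      then have "exp (- (norm x + ?D)\<^sup>2 / (4 * s)) \<le> exp (- (norm (x - y))\<^sup>2 / (4 * s))"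
        using s by (simp add: divide_right_mono)
      then have "exp (- (norm x + ?D)\<^sup>2 / (4 * s)) * c \<le> exp (- (norm (x - y))\<^sup>2 / (4 * s)) * \<phi> y"
        using c True by (intro mult_mono) auto
      then show ?thesis using True by (simp add: mult.commute)
    qed (use \<phi> in simp)
  qed
  moreover have "(LINT y|lborel. indicator (ball x0 r) y * (c * exp (- (norm x + ?D)\<^sup>2 / (4 * s))))
      = c * exp (- (norm x + ?D)\<^sup>2 / (4 * s)) * measure lborel (ball x0 r)"
    by simp
  ultimately show ?thesis
    using s unfolding heat_semigroup_def by (simp only: if_not_P less_imp_neq[symmetric]) (auto intro: mult_left_mono)
qed

lemma C0_continuous_bounded:
  assumes "f \<in> C0"
  shows "continuous_on UNIV f" "\<exists>M. \<forall>x. f x \<le> M"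
proof -
  obtain \<phi> where \<phi>: "f = apply_bcontfun \<phi>" using assms by (auto simp: C0_def)
  show "continuous_on UNIV f" unfolding \<phi> by (rule continuous_on_apply_bcontfun)
  show "\<exists>M. \<forall>x. f x \<le> M"
    unfolding \<phi> using norm_bounded[of \<phi>] by (metis abs_ge_self order_trans real_norm_def)
qed

lemma initial_datum_ball:
  fixes f :: "real^'n \<Rightarrow> real"
  assumes "f \<in> C0" "\<forall>x. 0 \<le> f x" "f \<noteq> (\<lambda>x. 0)"
  shows "\<exists>x0 r c. 0 < r \<and> 0 < c \<and> (\<forall>y\<in>ball x0 r. c \<le> f y)"
proof -
  obtain x0 where x0: "0 < f x0" using assms by (metis ext order_le_less)
  have "isCont f x0" using C0_continuous_bounded(1)[OF assms(1)] by (simp add: continuous_on_eq_continuous_at)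
  then have "\<forall>\<^sub>F y in nhds x0. f x0 / 2 < f y"
    using x0 by (intro order_tendstoD) (auto simp: isCont_def tendsto_at_iff_tendsto_nhds)
  then obtain r where "0 < r" "\<forall>y. dist y x0 < r \<longrightarrow> f x0 / 2 < f y"
    by (auto simp: eventually_nhds_metric)
  then show ?thesis using x0
    by (intro exI[of _ x0] exI[of _ r] exI[of _ "f x0 / 2"]) (auto simp: dist_commute less_imp_le)
qed

lemma heat_semigroup_pos:
  fixes f :: "real^'n \<Rightarrow> real"
  assumes f: "f \<in> C0" "\<forall>x. 0 \<le> f x" "f \<noteq> (\<lambda>x. 0)" and s: "0 < s"
  shows "0 < heat_semigroup s f x"
proof -
  obtain x0 r c where b: "0 < r" "0 < c" "\<forall>y\<in>ball x0 r. c \<le> f y" using initial_datum_ball[OF f] by auto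
  obtain M where M: "\<forall>x. f x \<le> M" using C0_continuous_bounded[OF f(1)] by auto
  have "0 < measure lborel (ball x0 r)" using content_ball_pos[OF b(1)] by simp
  then have "0 < (4 * pi * s) powr (- real CARD('n) / 2) *
      (c * exp (- (norm x + (norm x0 + r))\<^sup>2 / (4 * s)) * measure lborel (ball x0 r))"
    using b s by simp
  also have "\<dots> \<le> heat_semigroup s f x"
    using f b M s C0_continuous_bounded(1)[OF f(1)]
    by (intro heat_semigroup_lower_bound[where M=M]) (auto intro: borel_measurable_continuous_onI)
  finally show ?thesis .
qed

text \<open>After the shift the Gaussian rate is at most \<open>1 / (4 * \<epsilon>)\<close>, and
  (|x| + D)^2 <= 2 |x|^2 + 2 D^2 separates \<open>x\<close> from the ball, which gives
  \<open>\<kappa> = 1 / (2 * \<epsilon>)\<close> with the \<open>D\<close> part moved into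
  \<open>g\<close>. Dividing by \<open>W\<close>, a bound of the barrier up to \<open>T\<close>,
  inserts the barrier; enlarging |x| to |x| + sqrt t gives the shape that the Duhamel step
  preserves.\<close>

lemma heat_semigroup_initial_bound:
  fixes f :: "real^'n \<Rightarrow> real"
  assumes f: "f \<in> C0" "\<forall>x. 0 \<le> f x" "f \<noteq> (\<lambda>x. 0)"
    and q: "q < 1" and \<gamma>: "0 < \<gamma>" "\<gamma> < 2" and \<epsilon>: "0 < \<epsilon>" and T: "0 < T"
  shows "\<exists>\<theta>>0. \<exists>\<kappa>\<ge>0. \<forall>t x. 0 < t \<longrightarrow> t \<le> T \<longrightarrow>
    \<theta> * exp (- \<kappa> * (norm x + sqrt t)\<^sup>2) * lower_barrier q \<gamma> t x \<le> heat_semigroup (t + \<epsilon>) f x"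
proof -
  obtain x0 r c where b: "0 < r" "0 < c" "\<forall>y\<in>ball x0 r. c \<le> f y" using initial_datum_ball[OF f] by auto
  obtain M where M: "\<forall>x. f x \<le> M" using C0_continuous_bounded[OF f(1)] by auto
  define D where "D = norm x0 + r"
  define V where "V = measure lborel (ball x0 r)"
  define W where "W = ((1 - q) * eta0 TYPE('n) q \<gamma>) powr (1 / (1 - q)) * T powr ((1 - \<gamma> / 2) / (1 - q))"
  define g where "g = (4 * pi * (T + \<epsilon>)) powr (- real CARD('n) / 2) * c * exp (- D\<^sup>2 / (2 * \<epsilon>)) * V"
  have V: "0 < V" using content_ball_pos[OF b(1)] by (simp add: V_def)
  have D: "0 \<le> D" using b by (simp add: D_def)
  have W: "0 < W" using q eta0_pos[of \<gamma> q, where 'n='n] \<gamma> T by (simp add: W_def)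
  have g: "0 < g" using V b T \<epsilon> by (simp add: g_def)
  show ?thesis
  proof (rule exI[of _ "g / W"], rule conjI, simp add: g W,
      rule exI[of _ "1 / (2 * \<epsilon>)"], intro conjI allI impI)
    show "0 \<le> 1 / (2 * \<epsilon>)" using \<epsilon> by simp
    fix t and x :: "real^'n" assume t: "0 < t" "t \<le> T"
    have "lower_barrier q \<gamma> t x \<le> W"
    proof -
      have "t powr ((1 - \<gamma> / 2) / (1 - q)) \<le> T powr ((1 - \<gamma> / 2) / (1 - q))"
        using t q \<gamma> by (intro powr_mono2) auto
      then show ?thesis
        using lower_barrier_bound[OF q _ t(1), of \<gamma> x] \<gamma> unfolding W_def
        by (meson less_imp_le mult_left_mono order_trans powr_ge_zero)
    qed
    then have "g / W * exp (- (1 / (2 * \<epsilon>)) * (norm x + sqrt t)\<^sup>2) * lower_barrier q \<gamma> t x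
      \<le> g / W * exp (- (1 / (2 * \<epsilon>)) * (norm x + sqrt t)\<^sup>2) * W"
      using g W by (intro mult_left_mono) auto
    also have "\<dots> = g * exp (- (1 / (2 * \<epsilon>)) * (norm x + sqrt t)\<^sup>2)" using W by simp
    also have "\<dots> \<le> g * exp (- (norm x)\<^sup>2 / (2 * \<epsilon>))"
    proof (intro mult_left_mono)
      have "(norm x)\<^sup>2 \<le> (norm x + sqrt t)\<^sup>2" using t by (intro power_mono) auto
      then show "exp (- (1 / (2 * \<epsilon>)) * (norm x + sqrt t)\<^sup>2) \<le> exp (- (norm x)\<^sup>2 / (2 * \<epsilon>))"
        using \<epsilon> by (simp add: divide_right_mono)
    qed (use g in simp)
    also have "\<dots> = (4 * pi * (T + \<epsilon>)) powr (- real CARD('n) / 2) * (c * exp (- (2 * (norm x)\<^sup>2 + 2 * D\<^sup>2) / (4 * \<epsilon>)) * V)"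
    proof -
      have "- (2 * (norm x)\<^sup>2 + 2 * D\<^sup>2) / (4 * \<epsilon>) = - D\<^sup>2 / (2 * \<epsilon>) + - (norm x)\<^sup>2 / (2 * \<epsilon>)"
        using \<epsilon> by (simp add: field_simps)
      then show ?thesis by (simp only: g_def exp_add mult_ac)
    qed
    also have "\<dots> \<le> (4 * pi * (t + \<epsilon>)) powr (- real CARD('n) / 2) * (c * exp (- (norm x + D)\<^sup>2 / (4 * (t + \<epsilon>))) * V)"
    proof (intro mult_mono mult_left_mono)
      show "(4 * pi * (T + \<epsilon>)) powr (- real CARD('n) / 2) \<le> (4 * pi * (t + \<epsilon>)) powr (- real CARD('n) / 2)"
        using t \<epsilon> by (intro powr_mono2') auto
      have "0 \<le> (norm x - D)\<^sup>2" by simp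
      then have "(norm x + D)\<^sup>2 \<le> 2 * (norm x)\<^sup>2 + 2 * D\<^sup>2" by (simp add: power2_eq_square algebra_simps)
      then have "(norm x + D)\<^sup>2 / (4 * (t + \<epsilon>)) \<le> (2 * (norm x)\<^sup>2 + 2 * D\<^sup>2) / (4 * \<epsilon>)"
        using t \<epsilon> by (intro frac_le) auto
      then show "exp (- (2 * (norm x)\<^sup>2 + 2 * D\<^sup>2) / (4 * \<epsilon>)) \<le> exp (- (norm x + D)\<^sup>2 / (4 * (t + \<epsilon>)))"
        by (simp del: minus_add_distrib)
    qed (use V b in auto)
    also have "\<dots> \<le> heat_semigroup (t + \<epsilon>) f x"
      unfolding V_def D_def using f b M t \<epsilon> C0_continuous_bounded(1)[OF f(1)]
      by (intro heat_semigroup_lower_bound[where M=M]) (auto intro: borel_measurable_continuous_onI)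
    finally show "g / W * exp (- (1 / (2 * \<epsilon>)) * (norm x + sqrt t)\<^sup>2) * lower_barrier q \<gamma> t x
      \<le> heat_semigroup (t + \<epsilon>) f x" .
  qed
qed

lemma nonneg_solution_admissible: "nonneg_solution \<gamma> q u0 u \<Longrightarrow> admissible u"
  by (auto simp: nonneg_solution_def intro: C0_curves_admissible)

lemma nonneg_solution_ge:
  assumes "nonneg_solution \<gamma> q u0 u" "\<forall>x. 0 \<le> u0 x" "0 \<le> t"
  shows "duhamel_term \<gamma> q u t x \<le> u t x" "heat_semigroup t u0 x \<le> u t x"
proof -
  have "u t x = heat_semigroup t u0 x + duhamel_term \<gamma> q u t x"
    using assms by (simp add: nonneg_solution_def)
  moreover have "0 \<le> duhamel_term \<gamma> q u t x"
    using assms by (intro duhamel_term_nonneg) (auto simp: nonneg_solution_def)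
  moreover have "0 \<le> heat_semigroup t u0 x"
    using assms by (intro heat_semigroup_nonneg) auto
  ultimately show "duhamel_term \<gamma> q u t x \<le> u t x" "heat_semigroup t u0 x \<le> u t x" by auto
qed

text \<open>A Gaussian multiple of the barrier is improved by repeated use of the Duhamel formula.
  Integrating over \<open>cball 0 R\<close> only, with \<open>q * (1 + R)\<^sup>2 < 1\<close>, makes the Gaussian exponents tend to \<open>0\<close>
  and leaves a constant multiple \<open>\<theta>\<close>. Integrating over the whole space then improves \<open>\<theta>\<close> to
  \<open>\<theta> powr q ^ k\<close>, which tends to \<open>1\<close>. The time shift \<open>\<epsilon>\<close> provides the initial Gaussian bound.\<close>

lemma barrier_le_shifted_solution:
  fixes u :: "real \<Rightarrow> real^'n \<Rightarrow> real"
  assumes q: "0 < q" "q < 1" and \<gamma>: "0 < \<gamma>" "\<gamma> < min 2 (real CARD('n))"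
    and u0: "u0 \<in> C0" "\<forall>x. 0 \<le> u0 x" "u0 \<noteq> (\<lambda>x. 0)" and u: "nonneg_solution \<gamma> q u0 u"
    and \<epsilon>: "0 < \<epsilon>" and T: "0 < T"
  shows "lower_barrier q \<gamma> T x \<le> u (T + \<epsilon>) x"
proof -
  have adm: "admissible u" using u by (rule nonneg_solution_admissible)
  obtain \<theta>0 \<kappa>0 where init: "0 < \<theta>0" "0 \<le> \<kappa>0"
    "\<And>t x. 0 < t \<Longrightarrow> t \<le> T \<Longrightarrow> \<theta>0 * exp (- \<kappa>0 * (norm x + sqrt t)\<^sup>2) * lower_barrier q \<gamma> t x \<le> heat_semigroup (t + \<epsilon>) u0 x"
    using heat_semigroup_initial_bound[OF u0 q(2) \<gamma>(1) _ \<epsilon> T] \<gamma> by auto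
  \<comment> \<open>\<open>M\<close> is the midpoint of 1 and \<open>1 / q\<close>, and (1 + R)^2 =
    M. On the ball of radius \<open>R\<close> the Gaussian exponent is therefore multiplied by
    \<open>\<mu> = q * M = (1 + q) / 2 < 1\<close> in each step.\<close>
  define M where "M = (1 + 1 / q) / 2"
  define R where "R = sqrt M - 1"
  define \<mu> where "\<mu> = q * M"
  define \<rho> where "\<rho> = partial_eta q \<gamma> (cball (0::real^'n) R) / eta0 TYPE('n) q \<gamma>"
  \<comment> \<open>Cutting to the ball costs the factor \<open>\<rho>\<close> each time. Below the
    fixed point \<open>\<rho> powr (1 / (1 - q))\<close> of the map sending \<open>\<theta>\<close>
    to \<open>\<theta> powr q * \<rho>\<close> this map does not decrease \<open>\<theta>\<close>,
    so one constant serves all steps.\<close>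
  define \<theta> where "\<theta> = min \<theta>0 (\<rho> powr (1 / (1 - q)))"
  have eta: "0 < eta0 TYPE('n) q \<gamma>" using eta0_pos[of \<gamma> q, where 'n='n] q \<gamma> by auto
  have M: "1 < M" using q by (simp add: M_def)
  then have R: "0 < R" by (simp add: R_def)
  have \<mu>: "0 \<le> \<mu>" "\<mu> < 1" using q by (auto simp: \<mu>_def M_def field_simps)
  have "0 < partial_eta q \<gamma> (cball (0::real^'n) R)"
    using q \<gamma> R by (intro partial_eta_pos[where U="ball 0 R"]) auto
  then have \<rho>: "0 < \<rho>" using eta by (simp add: \<rho>_def)
  have \<theta>: "0 < \<theta>" using init \<rho> by (simp add: \<theta>_def)
  have \<theta>_step: "\<theta> \<le> \<theta> powr q * \<rho>"
  proof -
    have "\<theta> powr (1 - q) \<le> (\<rho> powr (1 / (1 - q))) powr (1 - q)"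
      using \<theta> q by (intro powr_mono2) (auto simp: \<theta>_def)
    also have "\<dots> = \<rho>" using q \<rho> by (simp add: powr_powr)
    finally have "\<theta> powr q * \<theta> powr (1 - q) \<le> \<theta> powr q * \<rho>" by (intro mult_left_mono) auto
    then show ?thesis using \<theta> by (simp flip: powr_add)
  qed
  have gauss: "\<theta> * exp (- (\<mu> ^ k * \<kappa>0) * (norm x + sqrt t)\<^sup>2) * lower_barrier q \<gamma> t x \<le> u (t + \<epsilon>) x"
    if "0 < t" "t \<le> T" for k t x
    using that
  proof (induction k arbitrary: t x)
    case 0
    have "\<theta> * exp (- \<kappa>0 * (norm x + sqrt t)\<^sup>2) * lower_barrier q \<gamma> t x
      \<le> \<theta>0 * exp (- \<kappa>0 * (norm x + sqrt t)\<^sup>2) * lower_barrier q \<gamma> t x"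
      by (intro mult_right_mono) (auto simp: \<theta>_def lower_barrier_nonneg)
    also have "\<dots> \<le> heat_semigroup (t + \<epsilon>) u0 x" using 0 by (rule init)
    also have "\<dots> \<le> u (t + \<epsilon>) x" using u u0 0 \<epsilon> by (intro nonneg_solution_ge) auto
    finally show ?case by simp
  next
    case (Suc k)
    let ?\<kappa> = "\<mu> ^ k * \<kappa>0"
    have \<kappa>: "0 \<le> ?\<kappa>" using \<mu> init by simp
    have "?\<kappa> * (1 + norm z)\<^sup>2 \<le> ?\<kappa> * M" if "z \<in> cball (0::real^'n) R" for z
    proof -
      have "(1 + norm z)\<^sup>2 \<le> (1 + R)\<^sup>2" using that by (intro power_mono) auto
      also have "\<dots> = M" using M by (simp add: R_def)
      finally show ?thesis using \<kappa> by (rule mult_left_mono)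
    qed
    then have "\<theta> powr q * \<rho> * exp (- (q * ?\<kappa> * M) * (norm x + sqrt t)\<^sup>2) * lower_barrier q \<gamma> t x
      \<le> duhamel_term \<gamma> q u (t + \<epsilon>) x"
      unfolding \<rho>_def using Suc \<epsilon> \<theta> \<kappa>
      by (intro duhamel_term_barrier_step[OF q \<gamma> adm]) auto
    also have "\<dots> \<le> u (t + \<epsilon>) x" using u u0 Suc.prems \<epsilon> by (intro nonneg_solution_ge) auto
    finally have 1: "\<theta> powr q * \<rho> * exp (- (q * ?\<kappa> * M) * (norm x + sqrt t)\<^sup>2) * lower_barrier q \<gamma> t x \<le> u (t + \<epsilon>) x" .
    have "\<theta> * exp (- (\<mu> ^ Suc k * \<kappa>0) * (norm x + sqrt t)\<^sup>2) * lower_barrier q \<gamma> t x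
      \<le> \<theta> powr q * \<rho> * exp (- (\<mu> ^ Suc k * \<kappa>0) * (norm x + sqrt t)\<^sup>2) * lower_barrier q \<gamma> t x"
      using \<theta>_step by (intro mult_right_mono) (auto simp: lower_barrier_nonneg)
    also have "\<dots> \<le> u (t + \<epsilon>) x"
    proof -
      have "q * ?\<kappa> * M = \<mu> ^ Suc k * \<kappa>0" by (simp add: \<mu>_def mult_ac)
      then show ?thesis using 1 by (simp only:)
    qed
    finally show ?case .
  qed
  have const: "\<theta> * lower_barrier q \<gamma> t x \<le> u (t + \<epsilon>) x" if t: "0 < t" "t \<le> T" for t x
  proof (rule LIMSEQ_le_const2)
    show "(\<lambda>k. \<theta> * exp (- (\<mu> ^ k * \<kappa>0) * (norm x + sqrt t)\<^sup>2) * lower_barrier q \<gamma> t x)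
      \<longlonglongrightarrow> \<theta> * lower_barrier q \<gamma> t x"
      using \<mu> by (auto intro!: tendsto_eq_intros LIMSEQ_power_zero)
  qed (use gauss[OF t] in blast)
  have improved: "\<theta> powr (q ^ k) * lower_barrier q \<gamma> t x \<le> u (t + \<epsilon>) x" if "0 < t" "t \<le> T" for k t x
    using that
  proof (induction k arbitrary: t x)
    case 0
    then show ?case using const \<theta> by simp
  next
    case (Suc k)
    \<comment> \<open>With \<open>\<kappa> = 0\<close> the whole space is allowed, the ratio to
      \<open>eta0\<close> is 1, and nothing is lost but the power \<open>q\<close>.\<close>
    have "(\<theta> powr (q ^ k)) powr q * (partial_eta q \<gamma> (UNIV::(real^'n) set) / eta0 TYPE('n) q \<gamma>)
        * exp (- (q * 0 * 1) * (norm x + sqrt t)\<^sup>2) * lower_barrier q \<gamma> t x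
      \<le> duhamel_term \<gamma> q u (t + \<epsilon>) x"
      using Suc \<epsilon> by (intro duhamel_term_barrier_step[OF q \<gamma> adm]) auto
    also have "\<dots> \<le> u (t + \<epsilon>) x" using u u0 Suc.prems \<epsilon> by (intro nonneg_solution_ge) auto
    finally show ?case using eta by (simp add: partial_eta_UNIV powr_powr mult.commute)
  qed
  have "(\<lambda>k. \<theta> powr (q ^ k) * lower_barrier q \<gamma> T x) \<longlonglongrightarrow> \<theta> powr 0 * lower_barrier q \<gamma> T x"
    using q \<theta> by (intro tendsto_intros LIMSEQ_power_zero) auto
  then have "\<theta> powr 0 * lower_barrier q \<gamma> T x \<le> u (T + \<epsilon>) x"
    by (rule LIMSEQ_le_const2) (use improved[OF T] in blast)
  then show ?thesis using \<theta> by simp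
qed

text \<open>The shifted bound holds for every positive shift; continuity of \<open>u\<close> in time
  lets the shift tend to 0.\<close>

lemma barrier_le_solution:
  fixes u :: "real \<Rightarrow> real^'n \<Rightarrow> real"
  assumes q: "0 < q" "q < 1" and \<gamma>: "0 < \<gamma>" "\<gamma> < min 2 (real CARD('n))"
    and u0: "u0 \<in> C0" "\<forall>x. 0 \<le> u0 x" "u0 \<noteq> (\<lambda>x. 0)" and u: "nonneg_solution \<gamma> q u0 u"
    and t: "0 \<le> t"
  shows "lower_barrier q \<gamma> t x \<le> u t x"
proof (cases "t = 0")
  case True
  moreover have "0 \<le> u t x" using u t unfolding nonneg_solution_def by blast
  ultimately show ?thesis by simp
next
  case False
  then have t: "0 < t" using t by simp
  have "continuous_on {0..} (\<lambda>s. (\<lambda>(t, x). u t x) (s, x))"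
    using u by (intro continuous_on_compose2[OF C0_curves_continuous]) (auto simp: nonneg_solution_def intro!: continuous_intros)
  then have c: "continuous_on {0..} (\<lambda>s. u s x)" by simp
  have "(\<lambda>n. t + inverse (real (Suc n))) \<longlonglongrightarrow> t + 0"
    by (intro tendsto_intros LIMSEQ_inverse_real_of_nat)
  then have "(\<lambda>n. u (t + inverse (real (Suc n))) x) \<longlonglongrightarrow> u t x"
    using t by (intro continuous_on_tendsto_compose[OF c]) auto
  moreover have "lower_barrier q \<gamma> t x \<le> u (t + inverse (real (Suc n))) x" for n
    using t by (intro barrier_le_shifted_solution[OF q \<gamma> u0 u]) auto
  ultimately show ?thesis by (intro LIMSEQ_le_const) auto
qed

section \<open>Uniqueness\<close>

text \<open>Subadditivity of the concave power: (a - b)/a and b/a sum to 1, and each is at most its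
  own power \<open>q\<close>. It needs no positive lower bound on the arguments, so it serves for
  the first, crude estimate of two solutions.\<close>

lemma powr_diff_le_powr_diff:
  fixes a b q :: real
  assumes "0 \<le> a" "0 \<le> b" "0 < q" "q \<le> 1"
  shows "\<bar>a powr q - b powr q\<bar> \<le> \<bar>a - b\<bar> powr q"
proof -
  have main: "a powr q - b powr q \<le> (a - b) powr q" if ab: "0 \<le> b" "b \<le> a" for a b :: real
  proof (cases "a = 0")
    case True
    then show ?thesis using ab by simp
  next
    case False
    then have a: "0 < a" using ab by simp
    have le: "z \<le> z powr q" if "0 \<le> z" "z \<le> 1" for z :: real
    proof (cases "z = 0")
      case False
      then show ?thesis using powr_mono'[of q 1 z] that assms by simp
    qed simp
    have "1 = (a - b) / a + b / a" using a by (simp add: diff_divide_distrib)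
    also have "\<dots> \<le> ((a - b) / a) powr q + (b / a) powr q"
      using a ab by (intro add_mono le) auto
    also have "\<dots> = ((a - b) powr q + b powr q) / a powr q"
      using a ab by (simp add: powr_divide add_divide_distrib)
    finally show ?thesis using a by (simp add: field_simps)
  qed
  show ?thesis
  proof (cases "b \<le> a")
    case True
    then have "b powr q \<le> a powr q" using assms by (intro powr_mono2) auto
    then show ?thesis using main[OF assms(2) True] True by simp
  next
    case False
    then have "a powr q \<le> b powr q" using assms by (intro powr_mono2) auto
    then show ?thesis using main[OF assms(1), of b] False by simp
  qed
qed

text \<open>Mean value theorem, with the decreasing derivative evaluated at the common lower bound
  \<open>c\<close>. Taking the barrier as \<open>c\<close> recovers Lipschitz dependence at positive
  times.\<close>

lemma powr_diff_le_linear: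
  fixes a b c q :: real
  assumes "0 < c" "c \<le> a" "c \<le> b" "0 < q" "q \<le> 1"
  shows "\<bar>a powr q - b powr q\<bar> \<le> q * c powr (q - 1) * \<bar>a - b\<bar>"
proof -
  have main: "a powr q - b powr q \<le> q * c powr (q - 1) * (a - b)" if ab: "c \<le> b" "b < a" for a b
  proof -
    have "\<exists>z>b. z < a \<and> a powr q - b powr q = (a - b) * (q * z powr (q - 1))"
      using assms ab by (intro MVT2) (auto intro!: derivative_eq_intros)
    then obtain z where z: "b < z" "a powr q - b powr q = (a - b) * (q * z powr (q - 1))" by auto
    have "z powr (q - 1) \<le> c powr (q - 1)" using assms ab z by (intro powr_mono2') auto
    then have "(a - b) * (q * z powr (q - 1)) \<le> (a - b) * (q * c powr (q - 1))"
      using ab assms by (intro mult_left_mono) auto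
    then show ?thesis using z by (simp add: mult_ac)
  qed
  consider "a = b" | "b < a" | "a < b" by linarith
  then show ?thesis
  proof cases
    case 2
    then have "b powr q \<le> a powr q" using assms by (intro powr_mono2) auto
    then show ?thesis using main[of b a] 2 assms by simp
  next
    case 3
    then have "a powr q \<le> b powr q" using assms by (intro powr_mono2) auto
    then show ?thesis using main[of a b] 3 assms by simp
  qed simp
qed

text \<open>Passing to (1 + sqrt s) to the power \<open>2 * \<gamma>\<close> before linearizing
  keeps the singularity mild: for s = sqrt \<sigma> / |y| it yields |y|^(-1/2), integrable in every
  dimension, whereas linearizing directly would yield |y|^(-1), not integrable at 0 for N =
  1.\<close>

lemma one_plus_powr_le:
  fixes s \<gamma> :: real
  assumes "0 \<le> s" "0 < \<gamma>" "\<gamma> \<le> 1 / 2"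
  shows "(1 + s) powr \<gamma> \<le> 1 + 2 * \<gamma> * sqrt s"
proof -
  have "sqrt (1 + s) \<le> 1 + sqrt s"
    using sqrt_add_le_add_sqrt[of 1 s] assms by simp
  have "(1 + s) powr \<gamma> = sqrt (1 + s) powr (2 * \<gamma>)"
    using assms by (simp add: powr_half_sqrt[symmetric] powr_powr)
  also have "\<dots> \<le> (1 + sqrt s) powr (2 * \<gamma>)"
    using assms \<open>sqrt (1 + s) \<le> 1 + sqrt s\<close> by (intro powr_mono2) auto
  also have "\<dots> \<le> 1 + 2 * \<gamma> * sqrt s"
    using powr_diff_le_linear[of 1 "1 + sqrt s" 1 "2 * \<gamma>"] assms by simp
  finally show ?thesis .
qed

section \<open>Estimates for the difference of two solutions\<close>

lemma duhamel_term_diff_bound: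
  fixes u v :: "real \<Rightarrow> real^'n \<Rightarrow> real"
  assumes u: "admissible u" and v: "admissible v" and \<gamma>: "0 \<le> \<gamma>" "\<gamma> < min 2 (real CARD('n))"
    and q: "0 < q" and t: "0 \<le> t"
    and h: "has_bochner_integral lborel (\<lambda>\<sigma>. indicator {0<..<t} \<sigma> * h \<sigma>) H"
    and le: "\<And>\<sigma>. 0 < \<sigma> \<Longrightarrow> \<sigma> < t \<Longrightarrow>
      \<bar>heat_semigroup_weighted \<gamma> (t - \<sigma>) (\<lambda>y. u \<sigma> y powr q - v \<sigma> y powr q) x\<bar> \<le> h \<sigma>"
  shows "\<bar>duhamel_term \<gamma> q u t x - duhamel_term \<gamma> q v t x\<bar> \<le> H"
proof -
  let ?F = "\<lambda>u \<sigma>. heat_semigroup_weighted \<gamma> (t - \<sigma>) (\<lambda>y. u \<sigma> y powr q) x"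
  have int: "set_integrable lborel {0<..<t} (?F u)" "set_integrable lborel {0<..<t} (?F v)"
    using duhamel_integrand_integrable[OF _ \<gamma> q t] u v by auto
  have eq: "?F u \<sigma> - ?F v \<sigma> = heat_semigroup_weighted \<gamma> (t - \<sigma>) (\<lambda>y. u \<sigma> y powr q - v \<sigma> y powr q) x"
    if \<sigma>: "0 < \<sigma>" "\<sigma> < t" for \<sigma>
  proof -
    obtain M N where MN: "\<forall>y. u \<sigma> y \<le> M" "\<forall>y. v \<sigma> y \<le> N"
      using u v \<sigma> unfolding admissible_def by (meson atLeastAtMost_iff less_imp_le order_refl)
    have nn: "0 \<le> u \<sigma> y" "0 \<le> v \<sigma> y" for y using u v \<sigma> by (auto simp: admissible_def)
    have [measurable]: "u \<sigma> \<in> borel_measurable borel" "v \<sigma> \<in> borel_measurable borel"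
      using admissible_measurable[OF u, of \<sigma>] admissible_measurable[OF v, of \<sigma>] \<sigma> by auto
    show ?thesis
    proof (rule heat_semigroup_weighted_diff[where M="max M N powr q"])
      show "\<bar>u \<sigma> y powr q\<bar> \<le> max M N powr q" "\<bar>v \<sigma> y powr q\<bar> \<le> max M N powr q" for y
        using nn[of y] q MN by (auto intro!: powr_mono2 simp: le_max_iff_disj)
    qed (use \<gamma> \<sigma> in auto)
  qed
  have 1: "duhamel_term \<gamma> q u t x - duhamel_term \<gamma> q v t x
    = (LINT \<sigma>|lborel. indicator {0<..<t} \<sigma> * (?F u \<sigma> - ?F v \<sigma>))"
    using int t unfolding duhamel_term_eq[OF t] set_lebesgue_integral_def set_integrable_def
    by (simp add: right_diff_distrib)
  have "\<bar>LINT \<sigma>|lborel. indicator {0<..<t} \<sigma> * (?F u \<sigma> - ?F v \<sigma>)\<bar>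
    \<le> (LINT \<sigma>|lborel. indicator {0<..<t} \<sigma> * h \<sigma>)"
  proof (rule integral_abs_bound_integral)
    show "integrable lborel (\<lambda>\<sigma>. indicator {0<..<t} \<sigma> * (?F u \<sigma> - ?F v \<sigma>))"
      using int by (simp add: set_integrable_def right_diff_distrib)
    show "integrable lborel (\<lambda>\<sigma>. indicator {0<..<t} \<sigma> * h \<sigma>)" using h by (auto simp: has_bochner_integral_iff)
    show "\<bar>indicator {0<..<t} \<sigma> * (?F u \<sigma> - ?F v \<sigma>)\<bar> \<le> indicator {0<..<t} \<sigma> * h \<sigma>" for \<sigma>
      using eq[of \<sigma>] le[of \<sigma>] by (auto simp: indicator_def)
  qed
  also have "\<dots> = H" using h by (simp add: has_bochner_integral_iff)
  finally show ?thesis unfolding 1 .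
qed

lemma nonneg_solution_diff:
  assumes "nonneg_solution \<gamma> q u0 u" "nonneg_solution \<gamma> q u0 v" "0 \<le> t"
  shows "u t x - v t x = duhamel_term \<gamma> q u t x - duhamel_term \<gamma> q v t x"
  using assms by (simp add: nonneg_solution_def)

text \<open>If \<open>\<bar>u - v\<bar> \<le> M\<close> on \<open>[0, t]\<close>, then \<open>\<bar>u - v\<bar> \<le> A * M powr q\<close> there; iterating replaces \<open>M\<close> by the
  fixed point \<open>A powr (1 / (1 - q))\<close>.\<close>

lemma nonneg_solution_diff_bound:
  assumes q: "0 < q" "q < 1" and \<gamma>: "0 < \<gamma>" "\<gamma> < min 2 (real CARD('n::finite))"
  shows "\<exists>L>0. \<forall>(u0::real^'n \<Rightarrow> real) u v t x. nonneg_solution \<gamma> q u0 u \<longrightarrow> nonneg_solution \<gamma> q u0 v \<longrightarrow> 0 < t \<longrightarrow>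
    \<bar>u t x - v t x\<bar> \<le> L * t powr ((1 - \<gamma> / 2) / (1 - q))"
proof -
  obtain K where K: "0 < K" "\<forall>\<tau>>0. \<forall>\<phi> M. \<forall>x::real^'n. \<phi> \<in> borel_measurable borel \<longrightarrow> (\<forall>y. \<bar>\<phi> y\<bar> \<le> M) \<longrightarrow>
    \<bar>heat_semigroup_weighted \<gamma> \<tau> \<phi> x\<bar> \<le> K * M * \<tau> powr (- \<gamma> / 2)"
    using heat_semigroup_weighted_bound[where 'n='n, of \<gamma>] \<gamma> by auto
  define K' where "K' = K / (1 - \<gamma> / 2)"
  have K': "0 < K'" using K \<gamma> by (simp add: K'_def)
  show ?thesis
  proof (intro exI[of _ "K' powr (1 / (1 - q))"] conjI allI impI)
    show "0 < K' powr (1 / (1 - q))" using K' by simp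
    fix u0 :: "real^'n \<Rightarrow> real" and u v and T :: real and x :: "real^'n"
    assume u: "nonneg_solution \<gamma> q u0 u" and v: "nonneg_solution \<gamma> q u0 v" and T: "0 < T"
    note adm = nonneg_solution_admissible[OF u] nonneg_solution_admissible[OF v]
    \<comment> \<open>The iteration runs on the window [0, T] with \<open>A\<close> depending on
      \<open>T\<close>. Since \<open>T\<close> is arbitrary, its fixed point \<open>A'\<close>
      evaluated at the end of the window gives the rate in \<open>T\<close>.\<close>
    define A where "A = K' * T powr (1 - \<gamma> / 2)"
    define A' where "A' = A powr (1 / (1 - q))"
    have A: "0 < A" using K' T by (simp add: A_def)
    then have A': "0 < A'" by (simp add: A'_def)
    have AA': "A * A' powr q = A'"
    proof -
      have "A * A' powr q = A powr 1 * A powr (q / (1 - q))" using A by (simp add: A'_def powr_powr)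
      also have "\<dots> = A powr (1 + q / (1 - q))" by (rule powr_add[symmetric])
      also have "1 + q / (1 - q) = 1 / (1 - q)" using q by (simp add: field_simps)
      finally show ?thesis by (simp add: A'_def)
    qed
    obtain M0 M1 where "\<forall>t\<in>{0..T}. \<forall>x. u t x \<le> M0" "\<forall>t\<in>{0..T}. \<forall>x. v t x \<le> M1"
      using adm unfolding admissible_def by meson
    moreover have nn: "0 \<le> u t x" "0 \<le> v t x" if "0 \<le> t" for t x
      using u v that by (auto simp: nonneg_solution_def)
    ultimately have M: "\<bar>u t x - v t x\<bar> \<le> max 1 (max M0 M1)" if "0 \<le> t" "t \<le> T" for t x
      using that nn[of t x] by (smt (verit) atLeastAtMost_iff)
    \<comment> \<open>Relative to the fixed point \<open>A'\<close>, one step takes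
      \<open>A' * \<beta> powr s\<close> to \<open>A' * \<beta> powr (q * s)\<close>; the
      \<open>max 1\<close> keeps \<open>\<beta>\<close> positive.\<close>
    define \<beta> where "\<beta> = max 1 (max M0 M1) / A'"
    have \<beta>: "0 < \<beta>" using A' by (simp add: \<beta>_def)
    have it: "\<bar>u t x - v t x\<bar> \<le> A' * \<beta> powr (q ^ k)" if "0 \<le> t" "t \<le> T" for k t x
      using that
    proof (induction k arbitrary: t x)
      case 0
      then show ?case using M[of t x] A' \<beta> by (simp add: \<beta>_def)
    next
      case (Suc k)
      let ?D = "A' * \<beta> powr (q ^ k)"
      have hb: "has_bochner_integral lborel (\<lambda>\<sigma>. indicator {0<..<t} \<sigma> * (K * ?D powr q * (t - \<sigma>) powr (- \<gamma> / 2)))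
        (K * ?D powr q * (t powr (- \<gamma> / 2 + 1) / (- \<gamma> / 2 + 1)))"
        using has_bochner_integral_mult_right[OF has_bochner_integral_powr_reflected[of "- \<gamma> / 2" t], of "K * ?D powr q"] \<gamma> Suc.prems
        by (simp add: mult_ac)
      have "\<bar>duhamel_term \<gamma> q u t x - duhamel_term \<gamma> q v t x\<bar> \<le> K * ?D powr q * (t powr (- \<gamma> / 2 + 1) / (- \<gamma> / 2 + 1))"
      proof (rule duhamel_term_diff_bound[OF adm _ \<gamma>(2) q(1) _ hb])
        fix \<sigma> assume \<sigma>: "0 < \<sigma>" "\<sigma> < t"
        have [measurable]: "u \<sigma> \<in> borel_measurable borel" "v \<sigma> \<in> borel_measurable borel"
          using admissible_measurable[OF adm(1), of \<sigma>] admissible_measurable[OF adm(2), of \<sigma>] \<sigma> by auto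
        have "\<bar>u \<sigma> y powr q - v \<sigma> y powr q\<bar> \<le> ?D powr q" for y
        proof -
          have "\<bar>u \<sigma> y powr q - v \<sigma> y powr q\<bar> \<le> \<bar>u \<sigma> y - v \<sigma> y\<bar> powr q"
            using nn[of \<sigma> y] \<sigma> q by (intro powr_diff_le_powr_diff) auto
          also have "\<dots> \<le> ?D powr q" using Suc.IH[of \<sigma> y] \<sigma> Suc.prems q by (intro powr_mono2) auto
          finally show ?thesis .
        qed
        then show "\<bar>heat_semigroup_weighted \<gamma> (t - \<sigma>) (\<lambda>y. u \<sigma> y powr q - v \<sigma> y powr q) x\<bar>
            \<le> K * ?D powr q * (t - \<sigma>) powr (- \<gamma> / 2)"
          using \<sigma> by (intro K(2)[rule_format]) auto
      qed (use \<gamma> Suc.prems in auto)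
      also have "\<dots> = K' * t powr (1 - \<gamma> / 2) * ?D powr q" by (simp add: K'_def)
      also have "\<dots> \<le> A * ?D powr q"
        unfolding A_def using Suc.prems \<gamma> K' by (intro mult_right_mono mult_left_mono powr_mono2) auto
      also have "\<dots> = (A * A' powr q) * \<beta> powr (q ^ Suc k)"
        using A' \<beta> by (simp add: powr_mult powr_powr mult_ac)
      finally show ?case
        using nonneg_solution_diff[OF u v Suc.prems(1), of x] by (simp add: AA')
    qed
    have "(\<lambda>k. A' * \<beta> powr (q ^ k)) \<longlonglongrightarrow> A' * \<beta> powr 0"
      using q \<beta> by (intro tendsto_intros LIMSEQ_power_zero) auto
    then have "\<bar>u T x - v T x\<bar> \<le> A' * \<beta> powr 0"
      by (rule LIMSEQ_le_const) (use it[of T x] T in auto)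
    also have "\<dots> = K' powr (1 / (1 - q)) * T powr ((1 - \<gamma> / 2) / (1 - q))"
      using \<beta> K' T by (simp add: A'_def A_def powr_mult powr_powr)
    finally show "\<bar>u T x - v T x\<bar> \<le> K' powr (1 / (1 - q)) * T powr ((1 - \<gamma> / 2) / (1 - q))" .
  qed
qed

text \<open>The contraction constant compares \<open>eta0\<close> at \<open>\<gamma>\<close> with
  \<open>eta0\<close> at 0. The plain Gaussian is the dominating function.\<close>

lemma eta0_tendsto:
  assumes q: "q < 1"
  shows "(eta0 TYPE('n::finite) q \<longlongrightarrow> eta0 TYPE('n) q 0) (at_right 0)"
proof -
  let ?f = "\<lambda>\<gamma> (z::real^'n). exp (- (norm z)\<^sup>2 / 4) * (1 + norm z) powr (- \<gamma> / (1 - q))"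
  have "((\<lambda>\<gamma>. LINT z|lborel. ?f \<gamma> z) \<longlongrightarrow> (LINT z|lborel. ?f 0 z)) (at_right 0)"
    unfolding tendsto_at_iff_sequentially
  proof (intro allI impI)
    fix X :: "nat \<Rightarrow> real" assume X: "\<forall>i. X i \<in> {0<..} - {0}" "X \<longlonglongrightarrow> 0"
    show "((\<lambda>\<gamma>. LINT z|lborel. ?f \<gamma> z) \<circ> X) \<longlonglongrightarrow> (LINT z|lborel. ?f 0 z)"
      unfolding comp_def
    proof (rule integral_dominated_convergence[where w="\<lambda>z. exp (- (norm z)\<^sup>2 / 4)"])
      show "integrable lborel (\<lambda>z::real^'n. exp (- (norm z)\<^sup>2 / 4))" by (rule integrable_gauss)
      have nz: "1 + norm z \<noteq> 0" for z :: "real^'n" by (smt (verit) norm_ge_zero)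
      show "AE z in lborel. (\<lambda>i. ?f (X i) z) \<longlonglongrightarrow> ?f 0 z"
        using X(2) q by (intro AE_I2 tendsto_intros) (auto simp: nz)
      show "AE z in lborel. norm (?f (X i) z) \<le> exp (- (norm z)\<^sup>2 / 4)" for i
      proof (rule AE_I2)
        fix z :: "real^'n"
        have "0 < X i" using X(1) by auto
        then have "(1 + norm z) powr (- X i / (1 - q)) \<le> 1"
          using powr_mono2'[of "- X i / (1 - q)" 1 "1 + norm z"] q by (simp add: divide_nonpos_pos)
        then show "norm (?f (X i) z) \<le> exp (- (norm z)\<^sup>2 / 4)" by simp
      qed
    qed auto
  qed
  then show ?thesis unfolding eta0_def by (rule tendsto_mult_left)
qed

text \<open>Since \<open>u\<close> and \<open>v\<close> lie above the barrier, the mean value theorem bounds \<open>\<bar>u\<^sup>q - v\<^sup>q\<bar>\<close> by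
  \<open>q w\<^sup>q\<^sup>-\<^sup>1 \<bar>u - v\<bar>\<close>, and \<open>w\<^sup>q\<^sup>-\<^sup>1 \<bar>y\<bar>\<^sup>-\<^sup>\<gamma>\<close> is a multiple of \<open>\<sigma>\<^sup>-\<^sup>1 (1 + \<surd>\<sigma> / \<bar>y\<bar>)\<^sup>\<gamma>\<close>. Bounding the last factor
  by \<open>1 + 2 \<gamma> (\<surd>\<sigma> / \<bar>y\<bar>)\<^sup>1\<^sup>/\<^sup>2\<close> isolates the leading constant \<open>q\<close> from a term that is small with \<open>\<gamma>\<close>.\<close>

lemma nonneg_solution_contraction:
  shows "\<exists>K\<ge>0. \<forall>q \<gamma> (u0::real^'n \<Rightarrow> real) u v L t x. 0 < q \<longrightarrow> q < 1 \<longrightarrow> 0 < \<gamma> \<longrightarrow> \<gamma> \<le> 1 / 2 \<longrightarrow> \<gamma> \<le> 2 * q \<longrightarrow>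
    u0 \<in> C0 \<longrightarrow> (\<forall>x. 0 \<le> u0 x) \<longrightarrow> u0 \<noteq> (\<lambda>x. 0) \<longrightarrow>
    nonneg_solution \<gamma> q u0 u \<longrightarrow> nonneg_solution \<gamma> q u0 v \<longrightarrow> 0 \<le> L \<longrightarrow>
    (\<forall>\<sigma>>0. \<forall>y. \<bar>u \<sigma> y - v \<sigma> y\<bar> \<le> L * \<sigma> powr ((1 - \<gamma> / 2) / (1 - q))) \<longrightarrow> 0 < t \<longrightarrow>
    \<bar>u t x - v t x\<bar> \<le> q / ((1 - q) * eta0 TYPE('n) q \<gamma>) *
      (eta0 TYPE('n) q 0 * (1 - q) / (1 - \<gamma> / 2) + K * \<gamma>) * L * t powr ((1 - \<gamma> / 2) / (1 - q))"
proof -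
  let ?e = "\<lambda>z::real^'n. exp (- (norm z)\<^sup>2 / 4)"
  let ?c = "(4 * pi) powr (- real CARD('n) / 2)"
  \<comment> \<open>The correction term carries the weight |y|^(-1/2) whatever
    \<open>\<gamma>\<close> is, so one constant \<open>k\<close> serves all
    \<open>\<gamma>\<close>.\<close>
  have "(1 / 2 :: real) < CARD('n)"
    using zero_less_card_finite[where 'a='n] by linarith
  then obtain k where k: "0 < k"
    "\<And>(x::real^'n) s. 0 < s \<Longrightarrow> integrable lborel (\<lambda>z. ?e z * norm (x + s *\<^sub>R z) powr (- (1 / 2)))"
    "\<And>(x::real^'n) s. 0 < s \<Longrightarrow> (LINT z|lborel. ?e z * norm (x + s *\<^sub>R z) powr (- (1 / 2))) \<le> k * s powr (- (1 / 2))"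
    using gauss_weight_bound_scaled[where 'a="real^'n", of "1 / 2"] by auto
  define K where "K = ?c * k"
  have K: "0 < K" using k by (simp add: K_def)
  show ?thesis
  \<comment> \<open>The factor 8/3 is 2 from \<open>one_plus_powr_le\<close> times 4/3 from
    integrating \<open>(t - \<sigma>) powr (- 1 / 4)\<close>.\<close>
  proof (intro exI[of _ "8 / 3 * K"] conjI allI impI)
    show "0 \<le> 8 / 3 * K" using K by simp
    fix q \<gamma> L t :: real and u0 :: "real^'n \<Rightarrow> real" and u v and x :: "real^'n"
    assume q: "0 < q" "q < 1" and \<gamma>: "0 < \<gamma>" "\<gamma> \<le> 1 / 2" "\<gamma> \<le> 2 * q"
      and u0: "u0 \<in> C0" "\<forall>x. 0 \<le> u0 x" "u0 \<noteq> (\<lambda>x. 0)"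
      and u: "nonneg_solution \<gamma> q u0 u" and v: "nonneg_solution \<gamma> q u0 v" and L: "0 \<le> L"
      and le: "\<forall>\<sigma>>0. \<forall>y. \<bar>u \<sigma> y - v \<sigma> y\<bar> \<le> L * \<sigma> powr ((1 - \<gamma> / 2) / (1 - q))" and t: "0 < t"
    note adm = nonneg_solution_admissible[OF u] nonneg_solution_admissible[OF v]
    define m where "m = (1 - \<gamma> / 2) / (1 - q)"
    define eta where "eta = eta0 TYPE('n) q \<gamma>"
    define \<kappa> where "\<kappa> = eta0 TYPE('n) q 0"
    define E where "E = q / ((1 - q) * eta) * L"
    \<comment> \<open>This is equivalent to \<open>\<gamma> \<le> 2 * q\<close>. It makes
      \<open>m - 3 / 4\<close> positive, which the monotonicity step in \<open>kernel\<close>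
      needs.\<close>
    have m: "1 \<le> m" using q \<gamma> by (simp add: m_def)
    have eta: "0 < eta" using eta0_pos[of \<gamma> q, where 'n='n] q \<gamma> by (simp add: eta_def)
    have \<kappa>: "\<kappa> = ?c * (LINT z|lborel. ?e z)"
    proof -
      have "(1 + norm z) powr 0 = 1" for z :: "real^'n" by (smt (verit) norm_ge_zero powr_zero_eq_one)
      then show ?thesis by (simp add: \<kappa>_def eta0_def)
    qed
    have E: "0 \<le> E" using q eta L by (simp add: E_def)
    have \<gamma>N: "\<gamma> < min 2 (real CARD('n))" using \<gamma> \<open>1 / 2 < real CARD('n)\<close> by linarith
    have kernel: "\<bar>heat_semigroup_weighted \<gamma> (t - \<sigma>) (\<lambda>y. u \<sigma> y powr q - v \<sigma> y powr q) x\<bar>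
      \<le> E * (\<kappa> * \<sigma> powr (m - 1) + 2 * \<gamma> * K * t powr (m - 3 / 4) * (t - \<sigma>) powr (- 1 / 4))"
      if \<sigma>: "0 < \<sigma>" "\<sigma> < t" for \<sigma>
    proof -
      have [measurable]: "u \<sigma> \<in> borel_measurable borel" "v \<sigma> \<in> borel_measurable borel"
        using admissible_measurable[OF adm(1), of \<sigma>] admissible_measurable[OF adm(2), of \<sigma>] \<sigma> by auto
      define s where "s = sqrt (t - \<sigma>)"
      have s: "0 < s" using \<sigma> by (simp add: s_def)
      let ?\<phi> = "\<lambda>y. u \<sigma> y powr q - v \<sigma> y powr q"
      let ?G = "\<lambda>y::real^'n. E * \<sigma> powr (m - 1) * (1 + 2 * \<gamma> * \<sigma> powr (1 / 4) * norm y powr (- (1 / 2)))"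
      have pt: "norm y powr (- \<gamma>) * \<bar>?\<phi> y\<bar> \<le> ?G y" for y
      proof (cases "y = 0")
        case True
        then show ?thesis using E \<gamma> by simp
      next
        case False
        then have y: "0 < norm y" by simp
        define r where "r = norm y + sqrt \<sigma>"
        have r: "0 < r" using y \<sigma> by (simp add: r_def add_pos_pos)
        have "\<bar>?\<phi> y\<bar> \<le> q * lower_barrier q \<gamma> \<sigma> y powr (q - 1) * \<bar>u \<sigma> y - v \<sigma> y\<bar>"
          using q \<sigma> \<gamma> barrier_le_solution[OF q \<gamma>(1) \<gamma>N u0 u, of \<sigma> y] barrier_le_solution[OF q \<gamma>(1) \<gamma>N u0 v, of \<sigma> y]
          by (intro powr_diff_le_linear lower_barrier_pos) auto
        also have "\<dots> \<le> q * lower_barrier q \<gamma> \<sigma> y powr (q - 1) * (L * \<sigma> powr m)"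
          using le \<sigma> q by (intro mult_left_mono) (auto simp: m_def)
        also have "lower_barrier q \<gamma> \<sigma> y powr (q - 1) = r powr \<gamma> / (\<sigma> * ((1 - q) * eta))"
        proof -
          have e: "1 / (1 - q) * (q - 1) = - 1" "- \<gamma> / (1 - q) * (q - 1) = \<gamma>" using q by (auto simp: field_simps)
          have "lower_barrier q \<gamma> \<sigma> y powr (q - 1) = ((1 - q) * eta) powr (- 1) * \<sigma> powr (- 1) * r powr \<gamma>"
            unfolding lower_barrier_def r_def[symmetric] eta_def[symmetric]
            using q eta \<sigma> r by (simp only: powr_mult powr_powr e)
          then show ?thesis using q eta \<sigma> by (simp add: powr_minus_divide field_simps)
        qed
        also have "q * (r powr \<gamma> / (\<sigma> * ((1 - q) * eta))) * (L * \<sigma> powr m) = E * \<sigma> powr (m - 1) * r powr \<gamma>"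
          using \<sigma> by (simp add: E_def powr_diff mult_ac)
        finally have "norm y powr (- \<gamma>) * \<bar>?\<phi> y\<bar> \<le> norm y powr (- \<gamma>) * (E * \<sigma> powr (m - 1) * r powr \<gamma>)"
          by (intro mult_left_mono) auto
        also have "\<dots> = E * \<sigma> powr (m - 1) * (r / norm y) powr \<gamma>"
          using y r by (simp add: powr_minus_divide powr_divide)
        also have "\<dots> \<le> ?G y"
        proof (intro mult_left_mono)
          have "(r / norm y) powr \<gamma> = (1 + sqrt \<sigma> / norm y) powr \<gamma>"
            using y by (simp add: r_def add_divide_distrib)
          also have "\<dots> \<le> 1 + 2 * \<gamma> * sqrt (sqrt \<sigma> / norm y)"
            using \<sigma> \<gamma> y by (intro one_plus_powr_le) auto
          also have "sqrt (sqrt \<sigma> / norm y) = \<sigma> powr (1 / 4) * norm y powr (- (1 / 2))"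
            using \<sigma> y by (simp add: powr_half_sqrt[symmetric] powr_divide powr_powr powr_minus_divide)
          finally show "(r / norm y) powr \<gamma> \<le> 1 + 2 * \<gamma> * \<sigma> powr (1 / 4) * norm y powr (- (1 / 2))" by simp
        qed (use E in auto)
        finally show ?thesis .
      qed
      have Gz: "?e z * ?G (x + s *\<^sub>R z) = E * \<sigma> powr (m - 1) *
          (?e z + 2 * \<gamma> * \<sigma> powr (1 / 4) * (?e z * norm (x + s *\<^sub>R z) powr (- (1 / 2))))" for z
        by (simp add: algebra_simps)
      have "\<bar>heat_semigroup_weighted \<gamma> (t - \<sigma>) ?\<phi> x\<bar>
        = ?c * \<bar>LINT z|lborel. ?e z * norm (x + s *\<^sub>R z) powr (- \<gamma>) * ?\<phi> (x + s *\<^sub>R z)\<bar>"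
        using \<sigma> by (simp add: heat_semigroup_weighted_eq abs_mult s_def)
      also have "\<dots> \<le> ?c * (LINT z|lborel. ?e z * ?G (x + s *\<^sub>R z))"
      proof (intro mult_left_mono)
        have Gint: "integrable lborel (\<lambda>z. ?e z * ?G (x + s *\<^sub>R z))"
          unfolding Gz using k(2)[OF s] integrable_gauss[where 'a="real^'n"] by simp
        have ptz: "\<bar>?e z * norm (x + s *\<^sub>R z) powr (- \<gamma>) * ?\<phi> (x + s *\<^sub>R z)\<bar> \<le> ?e z * ?G (x + s *\<^sub>R z)" for z
          using mult_left_mono[OF pt[of "x + s *\<^sub>R z"], of "?e z"] by (simp add: abs_mult mult.assoc)
        then have "integrable lborel (\<lambda>z. ?e z * norm (x + s *\<^sub>R z) powr (- \<gamma>) * ?\<phi> (x + s *\<^sub>R z))"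
          by (intro Bochner_Integration.integrable_bound[OF Gint])
             (auto intro!: AE_I2 intro: order_trans[OF _ abs_ge_self])
        then show "\<bar>LINT z|lborel. ?e z * norm (x + s *\<^sub>R z) powr (- \<gamma>) * ?\<phi> (x + s *\<^sub>R z)\<bar>
            \<le> (LINT z|lborel. ?e z * ?G (x + s *\<^sub>R z))"
          using Gint ptz by (rule integral_abs_bound_integral)
      qed simp
      also have "\<dots> = E * \<sigma> powr (m - 1) * (\<kappa> + 2 * \<gamma> * \<sigma> powr (1 / 4) *
          (?c * (LINT z|lborel. ?e z * norm (x + s *\<^sub>R z) powr (- (1 / 2)))))"
        unfolding Gz using k(2)[OF s] integrable_gauss[where 'a="real^'n"] by (simp add: \<kappa> algebra_simps)
      also have "\<dots> \<le> E * \<sigma> powr (m - 1) * (\<kappa> + 2 * \<gamma> * \<sigma> powr (1 / 4) * (?c * (k * s powr (- (1 / 2)))))"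
        using E \<gamma> k(3)[OF s, of x] by (intro mult_left_mono add_left_mono) auto
      also have "s powr (- (1 / 2)) = (t - \<sigma>) powr (- 1 / 4)"
        using \<sigma> by (simp add: s_def powr_half_sqrt[symmetric] powr_powr)
      also have "E * \<sigma> powr (m - 1) * (\<kappa> + 2 * \<gamma> * \<sigma> powr (1 / 4) * (?c * (k * (t - \<sigma>) powr (- 1 / 4))))
        = E * (\<kappa> * \<sigma> powr (m - 1) + 2 * \<gamma> * K * (\<sigma> powr (m - 1) * \<sigma> powr (1 / 4)) * (t - \<sigma>) powr (- 1 / 4))"
        by (simp add: K_def algebra_simps)
      also have "\<sigma> powr (m - 1) * \<sigma> powr (1 / 4) = \<sigma> powr (m - 3 / 4)"
        by (simp flip: powr_add)
      \<comment> \<open>Replacing \<open>\<sigma>\<close> by \<open>t\<close> avoids a Beta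
        integral. It is harmless in the correction term, which already carries
        \<open>\<gamma>\<close>; the leading term keeps its exact power, since its constant must
        tend to \<open>q\<close>.\<close>
      also have "E * (\<kappa> * \<sigma> powr (m - 1) + 2 * \<gamma> * K * \<sigma> powr (m - 3 / 4) * (t - \<sigma>) powr (- 1 / 4))
        \<le> E * (\<kappa> * \<sigma> powr (m - 1) + 2 * \<gamma> * K * t powr (m - 3 / 4) * (t - \<sigma>) powr (- 1 / 4))"
        using E \<gamma> K \<sigma> m by (intro mult_left_mono add_left_mono mult_right_mono powr_mono2) auto
      finally show ?thesis .
    qed
    have "has_bochner_integral lborel (\<lambda>\<sigma>. indicator {0<..<t} \<sigma> *
          (E * (\<kappa> * \<sigma> powr (m - 1) + 2 * \<gamma> * K * t powr (m - 3 / 4) * (t - \<sigma>) powr (- 1 / 4))))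
        (E * (\<kappa> * (t powr m / m) + 2 * \<gamma> * K * t powr (m - 3 / 4) * (t powr (3 / 4) / (3 / 4))))"
    proof -
      have "has_bochner_integral lborel (\<lambda>\<sigma>. E * (\<kappa> * (indicator {0<..<t} \<sigma> * \<sigma> powr (m - 1))
            + 2 * \<gamma> * K * t powr (m - 3 / 4) * (indicator {0<..<t} \<sigma> * (t - \<sigma>) powr (- 1 / 4))))
          (E * (\<kappa> * (t powr m / m) + 2 * \<gamma> * K * t powr (m - 3 / 4) * (t powr (3 / 4) / (3 / 4))))"
        using has_bochner_integral_powr_from_0[of "m - 1" t] has_bochner_integral_powr_reflected[of "- 1 / 4" t] m t
        by (intro has_bochner_integral_mult_right has_bochner_integral_add) auto
      then show ?thesis by (simp add: algebra_simps)
    qed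
    from duhamel_term_diff_bound[OF adm _ \<gamma>N q(1) _ this kernel]
    have "\<bar>u t x - v t x\<bar> \<le> E * (\<kappa> * (t powr m / m) + 2 * \<gamma> * K * t powr (m - 3 / 4) * (t powr (3 / 4) / (3 / 4)))"
      using nonneg_solution_diff[OF u v, of t x] \<gamma> t by simp
    also have "\<dots> = E * (\<kappa> / m + 8 / 3 * K * \<gamma>) * t powr m"
    proof -
      have "t powr (m - 3 / 4) * t powr (3 / 4) = t powr m" by (simp flip: powr_add)
      then show ?thesis by (simp add: algebra_simps)
    qed
    also have "\<dots> = q / ((1 - q) * eta0 TYPE('n) q \<gamma>) *
      (eta0 TYPE('n) q 0 * (1 - q) / (1 - \<gamma> / 2) + 8 / 3 * K * \<gamma>) * L * t powr ((1 - \<gamma> / 2) / (1 - q))"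
      by (simp add: E_def m_def eta_def \<kappa>_def)
    finally show "\<bar>u t x - v t x\<bar> \<le> \<dots>" .
  qed
qed

text \<open>Feeding each bound back into \<open>nonneg_solution_contraction\<close> multiplies
  \<open>L\<close> by \<open>c \<gamma>\<close>. At \<open>\<gamma> = 0\<close> the two values of
  \<open>eta0\<close> and the factors \<open>1 - q\<close> cancel, so \<open>c \<gamma>\<close>
  tends to \<open>q < 1\<close>; the threshold depends only on \<open>q\<close> and the
  dimension.\<close>

lemma nonneg_solution_unique:
  assumes q: "0 < q" "q < 1"
  shows "\<exists>\<gamma>star. 0 < \<gamma>star \<and> \<gamma>star < min 2 (real CARD('n::finite)) \<and>
    (\<forall>\<gamma> (u0::real^'n \<Rightarrow> real) u v. 0 < \<gamma> \<longrightarrow> \<gamma> < \<gamma>star \<longrightarrow> u0 \<in> C0 \<longrightarrow> (\<forall>x. 0 \<le> u0 x) \<longrightarrow> u0 \<noteq> (\<lambda>x. 0) \<longrightarrow>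
      nonneg_solution \<gamma> q u0 u \<longrightarrow> nonneg_solution \<gamma> q u0 v \<longrightarrow> (\<forall>t\<ge>0. v t = u t))"
proof -
  obtain K where K: "0 \<le> K" "\<And>q \<gamma> (u0::real^'n \<Rightarrow> real) u v L t x. 0 < q \<Longrightarrow> q < 1 \<Longrightarrow> 0 < \<gamma> \<Longrightarrow> \<gamma> \<le> 1 / 2 \<Longrightarrow> \<gamma> \<le> 2 * q \<Longrightarrow>
    u0 \<in> C0 \<Longrightarrow> (\<forall>x. 0 \<le> u0 x) \<Longrightarrow> u0 \<noteq> (\<lambda>x. 0) \<Longrightarrow>
    nonneg_solution \<gamma> q u0 u \<Longrightarrow> nonneg_solution \<gamma> q u0 v \<Longrightarrow> 0 \<le> L \<Longrightarrow>
    (\<forall>\<sigma>>0. \<forall>y. \<bar>u \<sigma> y - v \<sigma> y\<bar> \<le> L * \<sigma> powr ((1 - \<gamma> / 2) / (1 - q))) \<Longrightarrow> 0 < t \<Longrightarrow>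
    \<bar>u t x - v t x\<bar> \<le> q / ((1 - q) * eta0 TYPE('n) q \<gamma>) *
      (eta0 TYPE('n) q 0 * (1 - q) / (1 - \<gamma> / 2) + K * \<gamma>) * L * t powr ((1 - \<gamma> / 2) / (1 - q))"
    using nonneg_solution_contraction[where 'n='n] by blast
  define c where "c = (\<lambda>\<gamma>. q / ((1 - q) * eta0 TYPE('n) q \<gamma>) * (eta0 TYPE('n) q 0 * (1 - q) / (1 - \<gamma> / 2) + K * \<gamma>))"
  have eta: "0 < eta0 TYPE('n) q \<gamma>" if "0 \<le> \<gamma>" for \<gamma> using eta0_pos[of \<gamma> q, where 'n='n] that q by simp
  have "(c \<longlongrightarrow> q / ((1 - q) * eta0 TYPE('n) q 0) * (eta0 TYPE('n) q 0 * (1 - q) / (1 - 0 / 2) + K * 0)) (at_right 0)"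
    unfolding c_def using q eta[of 0] by (intro tendsto_intros eta0_tendsto) auto
  then have "(c \<longlongrightarrow> q) (at_right 0)" using q eta[of 0] by simp
  then have "\<forall>\<^sub>F \<gamma> in at_right 0. c \<gamma> < 1" using q by (intro order_tendstoD)
  then obtain b where b: "0 < b" "\<And>\<gamma>. 0 < \<gamma> \<Longrightarrow> \<gamma> < b \<Longrightarrow> c \<gamma> < 1"
    by (auto simp: eventually_at_right_field)
  \<comment> \<open>\<open>b\<close> gives \<open>c \<gamma> < 1\<close>, while 1/2 and
    \<open>2 * q\<close> meet the hypotheses of the contraction; 1/2 also keeps the threshold below
    \<open>min 2 N\<close>.\<close>
  define \<gamma>star where "\<gamma>star = min b (min (1 / 2) (2 * q))"
  show ?thesis
  proof (intro exI[of _ \<gamma>star] conjI allI impI ext)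
    show "0 < \<gamma>star" using b q by (simp add: \<gamma>star_def)
    have "1 \<le> real CARD('n)" using zero_less_card_finite[where 'a='n] by linarith
    moreover have "\<gamma>star \<le> 1 / 2" by (simp add: \<gamma>star_def)
    ultimately show star: "\<gamma>star < min 2 (real CARD('n))" by linarith
    fix \<gamma> t :: real and u0 :: "real^'n \<Rightarrow> real" and u v and x :: "real^'n"
    assume \<gamma>: "0 < \<gamma>" "\<gamma> < \<gamma>star" and u0: "u0 \<in> C0" "\<forall>x. 0 \<le> u0 x" "u0 \<noteq> (\<lambda>x. 0)"
      and u: "nonneg_solution \<gamma> q u0 u" and v: "nonneg_solution \<gamma> q u0 v" and t: "0 \<le> t"
    have \<gamma>': "\<gamma> \<le> 1 / 2" "\<gamma> \<le> 2 * q" "c \<gamma> < 1" "\<gamma> < min 2 (real CARD('n))"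
      using \<gamma> b star by (auto simp: \<gamma>star_def)
    have c0: "0 \<le> c \<gamma>" using q \<gamma> \<gamma>' K eta[of 0] eta[of \<gamma>] by (simp add: c_def)
    obtain L where L: "0 < L" "\<And>t x. 0 < t \<Longrightarrow> \<bar>u t x - v t x\<bar> \<le> L * t powr ((1 - \<gamma> / 2) / (1 - q))"
      using nonneg_solution_diff_bound[OF q \<gamma>(1) \<gamma>'(4)] u v by blast
    have it: "\<bar>u t x - v t x\<bar> \<le> c \<gamma> ^ k * L * t powr ((1 - \<gamma> / 2) / (1 - q))" if "0 < t" for k t x
      using that
    proof (induction k arbitrary: t x)
      case 0
      then show ?case using L(2) by simp
    next
      case (Suc k)
      have "\<bar>u t x - v t x\<bar> \<le> c \<gamma> * (c \<gamma> ^ k * L) * t powr ((1 - \<gamma> / 2) / (1 - q))"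
        unfolding c_def using Suc c0 L
        by (intro K(2)[OF q \<gamma>(1) \<gamma>'(1,2) u0 u v]) (auto simp: c_def)
      then show ?case by (simp add: mult_ac)
    qed
    show "v t x = u t x"
    proof (cases "t = 0")
      case True
      then show ?thesis using nonneg_solution_diff[OF u v, of 0 x] by (simp add: duhamel_term_eq set_lebesgue_integral_def)
    next
      case False
      have "(\<lambda>k. c \<gamma> ^ k * L * t powr ((1 - \<gamma> / 2) / (1 - q))) \<longlonglongrightarrow> 0 * L * t powr ((1 - \<gamma> / 2) / (1 - q))"
        using c0 \<gamma>' by (intro tendsto_intros LIMSEQ_power_zero) auto
      then have "\<bar>u t x - v t x\<bar> \<le> 0 * L * t powr ((1 - \<gamma> / 2) / (1 - q))"
        by (rule LIMSEQ_le_const) (use it[of t x] t False in auto)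
      then show ?thesis by simp
    qed
  qed
qed

theorem theorem1p3:
  fixes q \<gamma>\<^sub>N :: real
  assumes q: "0 < q" "q < 1"
    and \<gamma>\<^sub>N: "\<gamma>\<^sub>N = min 2 (real CARD('n::finite))"
  shows
    "(\<forall>(\<gamma>::real) (u0 :: real^'n \<Rightarrow> real) (u :: real \<Rightarrow> real^'n \<Rightarrow> real).
        0 < \<gamma> \<and> \<gamma> < \<gamma>\<^sub>N \<and> u0 \<in> C0 \<and> (\<forall>x. 0 \<le> u0 x) \<and> u0 \<noteq> (\<lambda>x. 0) \<and>
        nonneg_solution \<gamma> q u0 u \<longrightarrow>
          (\<forall>t>0. \<forall>x. 0 < u t x) \<and>
          (\<forall>t\<ge>0. \<forall>x. lower_barrier q \<gamma> t x \<le> u t x) \<and>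
          (lower_barrier q \<gamma> :: real \<Rightarrow> real^'n \<Rightarrow> real) \<in> C0_curves \<and>
          (\<forall>t\<ge>0. \<forall>x::real^'n.
             lower_barrier q \<gamma> t x \<le> duhamel_term \<gamma> q (lower_barrier q \<gamma>) t x)) \<and>
     (\<exists>\<gamma>star::real. 0 < \<gamma>star \<and> \<gamma>star < \<gamma>\<^sub>N \<and>
        (\<forall>(\<gamma>::real) (u0 :: real^'n \<Rightarrow> real) (u :: real \<Rightarrow> real^'n \<Rightarrow> real).
           0 < \<gamma> \<and> \<gamma> < \<gamma>star \<and> u0 \<in> C0 \<and> (\<forall>x. 0 \<le> u0 x) \<and> u0 \<noteq> (\<lambda>x. 0) \<and>
           nonneg_solution \<gamma> q u0 u \<longrightarrow>
             (\<forall>v. nonneg_solution \<gamma> q u0 v \<longrightarrow> (\<forall>t\<ge>0. v t = u t))))"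
proof (intro conjI allI impI)
  fix \<gamma> :: real and u0 :: "real^'n \<Rightarrow> real" and u
  assume "0 < \<gamma> \<and> \<gamma> < \<gamma>\<^sub>N \<and> u0 \<in> C0 \<and> (\<forall>x. 0 \<le> u0 x) \<and> u0 \<noteq> (\<lambda>x. 0) \<and> nonneg_solution \<gamma> q u0 u"
  then have \<gamma>: "0 < \<gamma>" "\<gamma> < min 2 (real CARD('n))"
    and u0: "u0 \<in> C0" "\<forall>x. 0 \<le> u0 x" "u0 \<noteq> (\<lambda>x. 0)" and u: "nonneg_solution \<gamma> q u0 u"
    using \<gamma>\<^sub>N by auto
  \<comment> \<open>Strict positivity is read off the heat part alone, the Duhamel term being
    non-negative.\<close>
  show "0 < u t x" if "0 < t" for t x
    using heat_semigroup_pos[OF u0 that] nonneg_solution_ge(2)[OF u u0(2)] that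
    by (meson less_imp_le less_le_trans)
  show "lower_barrier q \<gamma> t x \<le> u t x" if "0 \<le> t" for t x
    using that by (rule barrier_le_solution[OF q \<gamma> u0 u])
  show "(lower_barrier q \<gamma> :: real \<Rightarrow> real^'n \<Rightarrow> real) \<in> C0_curves"
    using q \<gamma> by (intro lower_barrier_C0_curves) auto
  show "lower_barrier q \<gamma> t x \<le> duhamel_term \<gamma> q (lower_barrier q \<gamma>) t x" if "0 \<le> t" for t and x :: "real^'n"
    using that by (rule lower_barrier_subsolution[OF q \<gamma>])
next
  show "\<exists>\<gamma>star::real. 0 < \<gamma>star \<and> \<gamma>star < \<gamma>\<^sub>N \<and>
        (\<forall>(\<gamma>::real) (u0 :: real^'n \<Rightarrow> real) (u :: real \<Rightarrow> real^'n \<Rightarrow> real).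
           0 < \<gamma> \<and> \<gamma> < \<gamma>star \<and> u0 \<in> C0 \<and> (\<forall>x. 0 \<le> u0 x) \<and> u0 \<noteq> (\<lambda>x. 0) \<and>
           nonneg_solution \<gamma> q u0 u \<longrightarrow>
             (\<forall>v. nonneg_solution \<gamma> q u0 v \<longrightarrow> (\<forall>t\<ge>0. v t = u t)))"
    using nonneg_solution_unique[OF q, where 'n='n] unfolding \<gamma>\<^sub>N by blast
qed

end
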